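(* Let $\mathcal{H}$ be an infinite-dimensional complex reproducing kernel Hilbert space of functions on a set $X$, with kernels $k_w$ ($w\in X$). Let $\mathbf{a}=\{a_1,\dots,a_n\}$ and $\mathbf{b}=\{b_1,\dots,b_n\}$ be disjoint subsets of $X$ with the same cardinality $n$, such that $\det\left((k_{b_i}(a_j))_{i,j=1}^n\right)\neq0$. Let $\mathcal{Z}^0_{\mathbf{a}}$, $\mathcal{Z}^0_{\mathbf{b}}$ and $X_{\mathbf{ab}}$ be as defined in the context, and let $\gamma_{X_{\mathbf{ab}}}$ denote the smallest spectral value of $X_{\mathbf{ab}}$. Then for all $1\le i,j\le n$: 1. $$\frac{|\langle k_{a_i},k_{b_j}\rangle|}{\|k_{a_i}\|\|k_{b_j}\|}\le\|P_{\mathcal{Z}^0_{\mathbf{a}}}P_{\mathcal{Z}^0_{\mathbf{b}}}\|=\|P^\perp_{\mathcal{Z}^0_{\mathbf{a}}}P^\perp_{\mathcal{Z}^0_{\mathbf{b}}}\|<1.$$ 2. $$\gamma_{X_{\mathbf{ab}}}\le\arccos\left(\frac{|k_{a_i}(b_j)|}{k_{a_i}(a_i)^{1/2}k_{b_j}(b_j)^{1/2}}\right)=\arccos\left(\frac{|\langle k_{a_i},k_{b_j}\rangle|}{\|k_{a_i}\|\|k_{b_j}\|}\right).$$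
   Context: The kernel $k_w\in\mathcal{H}$ satisfies $f(w)=\langle f,k_w\rangle$ for all $f\in\mathcal{H}$. Let $\mathcal{Z}_{\mathbf{a}}$ and $\mathcal{Z}_{\mathbf{b}}$ be the subspaces of functions in $\mathcal{H}$ vanishing on $\mathbf{a}$ and on $\mathbf{b}$, respectively. $\mathcal{H}_0$ is the generic part of $\mathcal{Z}_{\mathbf{a}}$ and $\mathcal{Z}_{\mathbf{b}}$, i.e. the orthogonal complement of $(\mathcal{Z}_{\mathbf{a}}\cap\mathcal{Z}_{\mathbf{b}})\oplus(\mathcal{Z}_{\mathbf{a}}^\perp\cap\mathcal{Z}_{\mathbf{b}}^\perp)\oplus(\mathcal{Z}_{\mathbf{a}}\cap\mathcal{Z}_{\mathbf{b}}^\perp)\oplus(\mathcal{Z}_{\mathbf{a}}^\perp\cap\mathcal{Z}_{\mathbf{b}})$, which is the $2n$-dimensional space generated by $\{k_{a_i},k_{b_j}:1\le i,j\le n\}$. Put $\mathcal{Z}^0_{\mathbf{a}}=\mathcal{Z}_{\mathbf{a}}\cap\mathcal{H}_0=\mathcal{H}_0\ominus\langle k_{a_i}:1\le i\le n\rangle$ and $\mathcal{Z}^0_{\mathbf{b}}=\mathcal{Z}_{\mathbf{b}}\cap\mathcal{H}_0=\mathcal{H}_0\ominus\langle k_{b_j}:1\le j\le n\rangle$. $P_{\mathcal{S}}$ is the orthogonal projection of $\mathcal{H}_0$ onto a subspace $\mathcal{S}$, and $P_{\mathcal{S}}^\perp=1-P_{\mathcal{S}}$; orthogonal complements are taken in $\mathcal{H}_0$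 for subspaces of $\mathcal{H}_0$. $X_{\mathbf{ab}}$ is the exponent of the unique minimal geodesic, in the Grassmann manifold of $\mathcal{H}_0$, joining $(\mathcal{Z}^0_{\mathbf{a}})^\perp$ and $(\mathcal{Z}^0_{\mathbf{b}})^\perp$ (it is also the exponent of the unique one joining $\mathcal{Z}^0_{\mathbf{a}}$ and $\mathcal{Z}^0_{\mathbf{b}}$): the unique self-adjoint operator on $\mathcal{H}_0$ with $\|X_{\mathbf{ab}}\|\le\pi/2$, $X_{\mathbf{ab}}\mathcal{Z}^0_{\mathbf{a}}\subset(\mathcal{Z}^0_{\mathbf{a}})^\perp$, $X_{\mathbf{ab}}\mathcal{Z}^0_{\mathbf{b}}\subset(\mathcal{Z}^0_{\mathbf{b}})^\perp$ and $e^{iX_{\mathbf{ab}}}\mathcal{Z}^0_{\mathbf{a}}=\mathcal{Z}^0_{\mathbf{b}}$. The notation $\gamma_A$, for the smallest spectral value of $A$, is introduced for positive operators $A$. *)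

theory Defs
  imports "HOL-Analysis.Analysis"
begin

text \<open>
  Complex Hilbert spaces. The norm and the topology are those of the underlying real Hilbert
  space, whose inner product is the real part of the complex one. The complex inner product is
  linear in its first argument.
\<close>

class complex_hilbert = real_inner + complete_space +
  fixes scaleC :: "complex \<Rightarrow> 'a \<Rightarrow> 'a"  (infixr "*\<^sub>C" 75)
    and cinner :: "'a \<Rightarrow> 'a \<Rightarrow> complex"
  assumes scaleC_add_right: "c *\<^sub>C (x + y) = c *\<^sub>C x + c *\<^sub>C y"
    and scaleC_add_left: "(c + d) *\<^sub>C x = c *\<^sub>C x + d *\<^sub>C x"
    and scaleC_scaleC: "c *\<^sub>C d *\<^sub>C x = (c * d) *\<^sub>C x"
    and scaleC_one: "1 *\<^sub>C x = x"
    and scaleR_eq_scaleC: "r *\<^sub>R x = complex_of_real r *\<^sub>C x"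
    and cinner_commute: "cinner x y = cnj (cinner y x)"
    and cinner_add_left: "cinner (x + y) z = cinner x z + cinner y z"
    and cinner_scaleC_left: "cinner (c *\<^sub>C x) y = c * cinner x y"
    and inner_eq_Re_cinner: "inner x y = Re (cinner x y)"

global_interpretation complex_vector: vector_space "scaleC :: complex \<Rightarrow> 'a \<Rightarrow> 'a::complex_hilbert"
  defines csubspace = complex_vector.subspace
    and cspan = complex_vector.span
    and cdim = complex_vector.dim
  by unfold_locales (simp_all add: scaleC_add_right scaleC_add_left scaleC_scaleC scaleC_one)

text \<open>
  A reproducing kernel Hilbert space of functions on \<open>'x\<close>: an element \<open>f\<close> of the Hilbert space
  is identified with the function \<open>ev f\<close>, and the operations are pointwise. Boundedness of the
  point evaluations follows from the existence of the kernels.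
\<close>

locale rkhs =
  fixes ev :: "'h::complex_hilbert \<Rightarrow> 'x \<Rightarrow> complex"
    and k :: "'x \<Rightarrow> 'h"
  assumes ev_inj: "inj ev"
    and ev_add: "ev (f + g) w = ev f w + ev g w"
    and ev_scaleC: "ev (c *\<^sub>C f) w = c * ev f w"
    and reproducing: "ev f w = cinner f (k w)"

definition vanishing :: "('h \<Rightarrow> 'x \<Rightarrow> complex) \<Rightarrow> 'x set \<Rightarrow> 'h set" where
  "vanishing ev A = {f. \<forall>w\<in>A. ev f w = 0}"

text \<open>The orthogonal complement of \<open>S\<close> in the subspace \<open>M\<close>.\<close>

definition ocompl :: "'h::complex_hilbert set \<Rightarrow> 'h set \<Rightarrow> 'h set" where
  "ocompl M S = {x \<in> M. \<forall>y\<in>S. cinner x y = 0}"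

definition generic_part :: "'h::complex_hilbert set \<Rightarrow> 'h set \<Rightarrow> 'h set" where
  "generic_part S T = ocompl UNIV
     {p + q + r + s | p q r s. p \<in> S \<inter> T \<and> q \<in> ocompl UNIV S \<inter> ocompl UNIV T \<and>
        r \<in> S \<inter> ocompl UNIV T \<and> s \<in> ocompl UNIV S \<inter> T}"

text \<open>
  Operators on a closed subspace \<open>M\<close> are represented by functions on the whole space of which only
  the values on \<open>M\<close> matter; all notions below refer to these values only.
\<close>

definition operator_on :: "'h::complex_hilbert set \<Rightarrow> ('h \<Rightarrow> 'h) \<Rightarrow> bool" where
  "operator_on M T \<longleftrightarrow> (\<forall>x\<in>M. T x \<in> M) \<and> (\<forall>x\<in>M. \<forall>y\<in>M. T (x + y) = T x + T y) \<and>
     (\<forall>c. \<forall>x\<in>M. T (c *\<^sub>C x) = c *\<^sub>C T x) \<and> (\<exists>C. \<forall>x\<in>M. norm (T x) \<le> C * norm x)"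

definition opnorm_on :: "'h::complex_hilbert set \<Rightarrow> ('h \<Rightarrow> 'h) \<Rightarrow> real" where
  "opnorm_on M T = (SUP x\<in>{x \<in> M. norm x \<le> 1}. norm (T x))"

definition selfadjoint_on :: "'h::complex_hilbert set \<Rightarrow> ('h \<Rightarrow> 'h) \<Rightarrow> bool" where
  "selfadjoint_on M T \<longleftrightarrow> operator_on M T \<and> (\<forall>x\<in>M. \<forall>y\<in>M. cinner (T x) y = cinner x (T y))"

definition positive_on :: "'h::complex_hilbert set \<Rightarrow> ('h \<Rightarrow> 'h) \<Rightarrow> bool" where
  "positive_on M T \<longleftrightarrow> operator_on M T \<and> (\<forall>x\<in>M. cinner (T x) x \<in> \<real>\<^sub>\<ge>\<^sub>0)"

definition proj :: "'h::complex_hilbert set \<Rightarrow> 'h \<Rightarrow> 'h" where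
  "proj S x = (THE p. p \<in> S \<and> (\<forall>y\<in>S. cinner (x - p) y = 0))"

definition proj_perp :: "'h::complex_hilbert set \<Rightarrow> 'h \<Rightarrow> 'h" where
  "proj_perp S x = x - proj S x"

definition exp_op :: "('h::complex_hilbert \<Rightarrow> 'h) \<Rightarrow> 'h \<Rightarrow> 'h" where
  "exp_op T x = (\<Sum>m. (T ^^ m) x /\<^sub>R fact m)"

definition spectrum_on :: "'h::complex_hilbert set \<Rightarrow> ('h \<Rightarrow> 'h) \<Rightarrow> complex set" where
  "spectrum_on M T = {z. \<not> (\<exists>R. operator_on M R \<and>
     (\<forall>x\<in>M. R (T x - z *\<^sub>C x) = x \<and> T (R x) - z *\<^sub>C R x = x))}"

text \<open>The smallest spectral value of a self-adjoint operator, whose spectrum is real.\<close>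

definition min_spectral :: "'h::complex_hilbert set \<Rightarrow> ('h \<Rightarrow> 'h) \<Rightarrow> real" where
  "min_spectral M T = (LEAST r. complex_of_real r \<in> spectrum_on M T)"

text \<open>
  The absolute value of \<open>T\<close>, i.e. the positive operator \<open>A\<close> with \<open>A\<^sup>2 = T\<^sup>* T\<close>. It is unique on
  \<open>M\<close>; its values outside \<open>M\<close> are unspecified.
\<close>

definition abs_op :: "'h::complex_hilbert set \<Rightarrow> ('h \<Rightarrow> 'h) \<Rightarrow> 'h \<Rightarrow> 'h" where
  "abs_op M T = (SOME A. positive_on M A \<and>
     (\<forall>x\<in>M. \<forall>y\<in>M. cinner (A (A x)) y = cinner (T x) (T y)))"

text \<open>
  \<open>X\<close> is the exponent of the minimal geodesic of the Grassmann manifold of \<open>M\<close> from \<open>S\<close> to \<open>T\<close>.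
  For \<open>S\<close> and \<open>T\<close> in generic position in \<open>M\<close> this determines \<open>X\<close> on \<open>M\<close>.
\<close>

definition geodesic_exponent ::
  "'h::complex_hilbert set \<Rightarrow> 'h set \<Rightarrow> 'h set \<Rightarrow> ('h \<Rightarrow> 'h) \<Rightarrow> bool" where
  "geodesic_exponent M S T X \<longleftrightarrow> selfadjoint_on M X \<and> opnorm_on M X \<le> pi / 2 \<and>
     X ` S \<subseteq> ocompl M S \<and> X ` T \<subseteq> ocompl M T \<and> exp_op (\<lambda>x. \<i> *\<^sub>C X x) ` S = T"

end

theory Submission
  imports Defs "HOL-Computational_Algebra.Fundamental_Theorem_Algebra"
begin

text \<open>
  The generic part is the span \<open>K\<close> of the kernels, so everything takes place in finite dimension.
  Inside \<open>K\<close>, write \<open>A\<close> and \<open>B\<close> for the spans of the two families of kernels; \<open>Za\<close> and \<open>Zb\<close> are their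
  orthogonal complements. Since \<open>A \<inter> B = 0\<close>, all eigenvalues of \<open>P\<^sub>B P\<^sub>A P\<^sub>B\<close> are below 1.
  For \<open>z \<bottom> A\<close>, writing \<open>z = u + x\<close> with \<open>u \<in> A\<close> and \<open>x \<in> B\<close> gives \<open>\<langle>z, z\<rangle> = \<langle>P\<^sub>B z, x\<rangle>\<close>, which transfers
  the bound \<open>\<parallel>P\<^sub>A x\<parallel> \<le> s \<parallel>x\<parallel>\<close> to \<open>\<parallel>z - P\<^sub>B z\<parallel> \<le> s \<parallel>z\<parallel>\<close>.

  Let \<open>g\<close> be the smallest spectral value of \<open>|X|\<close>. The hypotheses do not force \<open>X\<close> to map \<open>A\<close> into \<open>Za\<close>,
  so \<open>sin X\<close> need not vanish in the block of \<open>Za\<close>. However, \<open>\<langle>X z, w\<rangle> = 0\<close> for \<open>z, w \<in> Za\<close>, hence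
  \<open>\<langle>e\<^sup>i\<^sup>X z, w\<rangle> = \<langle>(e\<^sup>i\<^sup>X - i m X) z, w\<rangle>\<close> for every \<open>m\<close>, and for \<open>m = sin g / g\<close> the operator in parentheses has
  norm at most \<open>cos g\<close>, because \<open>|e\<^sup>i\<^sup>l - i m l| \<le> cos g\<close> whenever \<open>g \<le> |l| \<le> \<pi>/2\<close>.
  For \<open>X\<close> itself, \<open>\<langle>X z, z\<rangle> = 0\<close> on \<open>Za\<close> makes the smallest spectral value nonpositive.
\<close>

section \<open>Orthonormal bases and projections\<close>

lemma cinner_add_right: "cinner x (y + z) = cinner x y + cinner x (z::'h::complex_hilbert)"
  by (metis cinner_add_left cinner_commute complex_cnj_add)

lemma cinner_scaleC_right: "cinner x (c *\<^sub>C y) = cnj c * cinner x (y::'h::complex_hilbert)"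
  by (metis cinner_commute cinner_scaleC_left complex_cnj_mult)

lemma cinner_zero_left [simp]: "cinner 0 (x::'h::complex_hilbert) = 0"
  by (metis add_cancel_right_left cinner_add_left)

lemma cinner_zero_right [simp]: "cinner (x::'h::complex_hilbert) 0 = 0"
  by (metis add_cancel_right_left cinner_add_right)

lemma cinner_diff_left: "cinner (x - y) z = cinner x z - cinner (y::'h::complex_hilbert) z"
  by (metis add_diff_cancel cinner_add_left diff_add_cancel)

lemma cinner_diff_right: "cinner x (y - z) = cinner x y - cinner x (z::'h::complex_hilbert)"
  by (metis add_diff_cancel cinner_add_right diff_add_cancel)

lemma cinner_sum_left: "cinner (\<Sum>i\<in>I. f i) x = (\<Sum>i\<in>I. cinner (f i) (x::'h::complex_hilbert))"
  by (induction I rule: infinite_finite_induct) (simp_all add: cinner_add_left)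

lemma cinner_sum_right: "cinner x (\<Sum>i\<in>I. f i) = (\<Sum>i\<in>I. cinner x (f i :: 'h::complex_hilbert))"
  by (induction I rule: infinite_finite_induct) (simp_all add: cinner_add_right)

lemma cinner_self: "cinner x x = complex_of_real ((norm (x::'h::complex_hilbert))\<^sup>2)"
proof (rule complex_eqI)
  show "Re (cinner x x) = Re (complex_of_real ((norm x)\<^sup>2))"
    by (simp add: power2_norm_eq_inner inner_eq_Re_cinner)
  have "Im (cinner x x) = - Im (cinner x x)"
    using cinner_commute[of x x] by (metis cnj.simps(2))
  then show "Im (cinner x x) = Im (complex_of_real ((norm x)\<^sup>2))" by simp
qed

lemma cinner_self_eq_0 [simp]: "cinner x x = 0 \<longleftrightarrow> x = (0::'h::complex_hilbert)"
  by (simp add: cinner_self)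

lemma cinner_eq_0_commute: "cinner x y = 0 \<longleftrightarrow> cinner y (x::'h::complex_hilbert) = 0"
  by (metis cinner_commute complex_cnj_zero_iff)

lemma norm_scaleC: "norm (c *\<^sub>C x) = cmod c * norm (x::'h::complex_hilbert)"
proof -
  have "complex_of_real ((norm (c *\<^sub>C x))\<^sup>2) = of_real ((cmod c * norm x)\<^sup>2)"
    unfolding cinner_self[symmetric] cinner_scaleC_left cinner_scaleC_right
    by (simp add: cinner_self power_mult_distrib) (use complex_norm_square[of c] in \<open>simp add: mult.commute[of c "cnj c"]\<close>)
  then have "(norm (c *\<^sub>C x))\<^sup>2 = (cmod c * norm x)\<^sup>2" by (simp only: of_real_eq_iff)
  then show ?thesis by (simp add: power2_eq_iff_nonneg)
qed

lemma cinner_Cauchy_Schwarz: "cmod (cinner x y) \<le> norm x * norm (y::'h::complex_hilbert)"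
proof (cases "cinner x y = 0")
  case False
  \<comment> \<open>Multiplying \<open>x\<close> by this phase makes the inner product equal to its
    modulus, so that Cauchy-Schwarz for the real inner product applies.\<close>
  define c where "c = cnj (sgn (cinner x y))"
  have c: "cmod c = 1" using False by (simp add: c_def norm_sgn)
  have "complex_of_real (cmod (cinner x y)) = c * cinner x y"
  proof -
    have "c * cinner x y = cnj (cinner x y) * cinner x y / of_real (cmod (cinner x y))"
      by (simp add: c_def sgn_eq)
    also have "\<dots> = of_real (cmod (cinner x y))"
      using False complex_norm_square[of "cinner x y"] by (simp add: mult.commute power2_eq_square divide_eq_eq)
    finally show ?thesis by simp
  qed
  then have "cmod (cinner x y) = inner (c *\<^sub>C x) y"
    by (metis Re_complex_of_real cinner_scaleC_left inner_eq_Re_cinner)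
  also have "\<dots> \<le> norm (c *\<^sub>C x) * norm y" by (rule norm_cauchy_schwarz)
  finally show ?thesis by (simp add: norm_scaleC c)
qed simp

lemma bounded_linear_scaleC_left: "bounded_linear (\<lambda>c. c *\<^sub>C (x::'h::complex_hilbert))"
  by (rule bounded_linear_intro[where K = "norm x"])
    (simp_all add: scaleC_add_left scaleR_eq_scaleC scaleC_scaleC norm_scaleC scaleR_conv_of_real)

lemma norm_Pythagoras:
  assumes "cinner x (y::'h::complex_hilbert) = 0"
  shows "(norm (x + y))\<^sup>2 = (norm x)\<^sup>2 + (norm y)\<^sup>2"
proof -
  have "inner x y = 0" using assms by (simp add: inner_eq_Re_cinner)
  then have "inner x y = 0" "inner y x = 0" by (simp_all add: inner_commute)
  then show ?thesis by (simp add: power2_norm_eq_inner inner_add_left inner_add_right)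
qed

lemma cinner_span_eq_0:
  assumes "y \<in> cspan E" "\<And>e. e \<in> E \<Longrightarrow> cinner x e = 0"
  shows "cinner x y = 0"
  using assms(1)
  by (induction rule: complex_vector.span_induct_alt)
    (simp_all add: assms(2) cinner_add_right cinner_scaleC_right)

text \<open>Because \<open>E\<close> is finite and spans exactly \<open>M\<close>, the predicate
  doubles below as the assumption that \<open>M\<close> is a finite-dimensional subspace.\<close>

definition onb :: "'h::complex_hilbert set \<Rightarrow> 'h set \<Rightarrow> bool" where
  "onb E M \<longleftrightarrow> finite E \<and> (\<forall>x\<in>E. \<forall>y\<in>E. cinner x y = (if x = y then 1 else 0)) \<and> cspan E = M"

text \<open>For \<open>E\<close> orthonormal this is the operator with eigenvalue
  \<open>\<mu> e\<close> at \<open>e\<close> that vanishes on the orthogonal complement of the span;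
  with all \<open>\<mu> e = 1\<close> it is the orthogonal projection onto the span. Projections and
  functions of \<open>X\<close> thus share one calculus.\<close>

definition diag_op :: "'h::complex_hilbert set \<Rightarrow> ('h \<Rightarrow> complex) \<Rightarrow> 'h \<Rightarrow> 'h" where
  "diag_op E \<mu> x = (\<Sum>e\<in>E. (\<mu> e * cinner x e) *\<^sub>C e)"

lemma onb_finite: "onb E M \<Longrightarrow> finite E"
  and onb_cinner: "onb E M \<Longrightarrow> x \<in> E \<Longrightarrow> y \<in> E \<Longrightarrow> cinner x y = (if x = y then 1 else 0)"
  and onb_span: "onb E M \<Longrightarrow> cspan E = M"
  by (auto simp: onb_def)

lemma onb_subspace: "onb E M \<Longrightarrow> csubspace M"
  using onb_span complex_vector.subspace_span by blast

lemma onb_mem: "onb E M \<Longrightarrow> e \<in> E \<Longrightarrow> e \<in> M"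
  using onb_span complex_vector.span_base by blast

lemma onb_norm: "onb E M \<Longrightarrow> e \<in> E \<Longrightarrow> norm e = 1"
  using onb_cinner[of E M e e] by (simp add: cinner_self power2_eq_1_iff flip: of_real_power)
    (metis norm_ge_zero neg_0_le_iff_le not_one_le_zero)

lemma diag_op_in: "onb E M \<Longrightarrow> diag_op E \<mu> x \<in> M"
  unfolding diag_op_def using onb_subspace onb_mem
  by (intro complex_vector.subspace_sum complex_vector.subspace_scale) blast+

lemma cinner_diag_op_basis:
  assumes "onb E M" "e \<in> E"
  shows "cinner (diag_op E \<mu> x) e = \<mu> e * cinner x e"
proof -
  have "cinner (diag_op E \<mu> x) e = (\<Sum>f\<in>E. \<mu> f * cinner x f * cinner f e)"
    by (simp add: diag_op_def cinner_sum_left cinner_scaleC_left)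
  also have "\<dots> = (\<Sum>f\<in>E. if f = e then \<mu> e * cinner x e else 0)"
    using assms by (intro sum.cong) (auto simp: onb_cinner)
  finally show ?thesis using assms by (simp add: onb_finite)
qed

lemma onb_orthogonal_all:
  assumes "onb E M" "y \<in> M" "\<And>e. e \<in> E \<Longrightarrow> cinner x e = 0"
  shows "cinner x y = 0"
  using assms(2,3) unfolding onb_span[OF assms(1), symmetric] by (rule cinner_span_eq_0)

lemma onb_expand:
  assumes "onb E M" "x \<in> M"
  shows "diag_op E (\<lambda>_. 1) x = x"
proof -
  have "x - diag_op E (\<lambda>_. 1) x \<in> M"
    using assms by (intro complex_vector.subspace_diff) (auto simp: onb_subspace diag_op_in)
  then have "cinner (x - diag_op E (\<lambda>_. 1) x) (x - diag_op E (\<lambda>_. 1) x) = 0"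
    by (rule onb_orthogonal_all[OF assms(1)])
      (simp add: cinner_diff_left cinner_diag_op_basis[OF assms(1)])
  then show ?thesis by simp
qed

lemma cinner_diag_op:
  "cinner (diag_op E \<mu> x) y = (\<Sum>e\<in>E. \<mu> e * cinner x e * cnj (cinner y e))"
  by (simp add: diag_op_def cinner_sum_left cinner_scaleC_left cinner_commute[symmetric])

lemma diag_op_diag_op:
  "onb E M \<Longrightarrow> diag_op E \<mu> (diag_op E \<nu> x) = diag_op E (\<lambda>e. \<mu> e * \<nu> e) x"
  unfolding diag_op_def[of E \<mu>] diag_op_def[of E "\<lambda>e. \<mu> e * \<nu> e"]
  by (simp add: cinner_diag_op_basis mult.assoc)

lemma diag_op_cong: "(\<And>e. e \<in> E \<Longrightarrow> \<mu> e = \<nu> e) \<Longrightarrow> diag_op E \<mu> x = diag_op E \<nu> x"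
  by (simp add: diag_op_def)

lemma norm_onb:
  assumes "onb E M" "x \<in> M"
  shows "(norm x)\<^sup>2 = (\<Sum>e\<in>E. (cmod (cinner x e))\<^sup>2)"
proof -
  have "complex_of_real ((norm x)\<^sup>2) = cinner (diag_op E (\<lambda>_. 1) x) x"
    by (simp only: onb_expand[OF assms] cinner_self)
  also have "\<dots> = complex_of_real (\<Sum>e\<in>E. (cmod (cinner x e))\<^sup>2)"
    by (simp add: cinner_diag_op complex_norm_square del: of_real_power)
  finally show ?thesis by (simp only: of_real_eq_iff)
qed

lemma norm_diag_op_le:
  assumes E: "onb E M" "x \<in> M" and C: "\<And>e. e \<in> E \<Longrightarrow> cmod (\<mu> e) \<le> C" "0 \<le> C"
  shows "norm (diag_op E \<mu> x) \<le> C * norm x"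
proof -
  have "(norm (diag_op E \<mu> x))\<^sup>2 = (\<Sum>e\<in>E. (cmod (\<mu> e))\<^sup>2 * (cmod (cinner x e))\<^sup>2)"
    using E by (subst norm_onb[OF E(1) diag_op_in[OF E(1)]])
      (intro sum.cong, auto simp: cinner_diag_op_basis norm_mult power_mult_distrib)
  also have "\<dots> \<le> (\<Sum>e\<in>E. C\<^sup>2 * (cmod (cinner x e))\<^sup>2)"
    using C by (intro sum_mono mult_right_mono power_mono) auto
  also have "\<dots> = (C * norm x)\<^sup>2"
    by (simp add: norm_onb[OF E] power_mult_distrib sum_distrib_left)
  finally show ?thesis using C(2) by (simp add: power2_le_iff_abs_le)
qed

lemma onb_exists:
  assumes "finite B"
  shows "\<exists>E. onb E (cspan B)"
  using assms
proof induction
  case empty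
  show ?case by (rule exI[of _ "{}"]) (simp add: onb_def)
next
  case (insert v B)
  then obtain E where E: "onb E (cspan B)" by blast
  \<comment> \<open>Gram-Schmidt: \<open>u\<close> is the component of \<open>v\<close> orthogonal
    to the span already treated. If it vanishes, \<open>v\<close> adds nothing to the span;
    otherwise its normalisation joins the basis.\<close>
  define u where "u = v - diag_op E (\<lambda>_. 1) v"
  have dB: "diag_op E (\<lambda>_. 1) v \<in> cspan B" by (rule diag_op_in[OF E])
  have uE: "cinner u e = 0" "cinner e u = 0" if "e \<in> E" for e
    using that E cinner_eq_0_commute[of u e] by (simp_all add: u_def cinner_diff_left cinner_diag_op_basis)
  show ?case
  proof (cases "u = 0")
    case True
    then have "v \<in> cspan B" using dB by (simp add: u_def)
    then show ?thesis using E by (metis complex_vector.span_redundant)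
  next
    case False
    define e0 where "e0 = complex_of_real (1 / norm u) *\<^sub>C u"
    have e0: "cinner e0 e0 = 1" using False
      unfolding e0_def cinner_scaleC_left cinner_scaleC_right
      by (simp add: cinner_self power2_eq_square)
    have e0E: "cinner e0 e = 0" "cinner e e0 = 0" if "e \<in> E" for e
      using uE[OF that] by (simp_all add: e0_def cinner_scaleC_left cinner_scaleC_right)
    have "v = diag_op E (\<lambda>_. 1) v + complex_of_real (norm u) *\<^sub>C e0"
      using False by (simp add: e0_def scaleC_scaleC scaleC_one) (simp add: u_def)
    moreover have "cspan B \<subseteq> cspan (insert e0 E)"
      using onb_span[OF E] complex_vector.span_mono[of E "insert e0 E"] by blast
    ultimately have "v \<in> cspan (insert e0 E)"
      using dB by (metis complex_vector.span_add complex_vector.span_base complex_vector.span_scale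
          insertI1 subsetD)
    then have "insert v B \<subseteq> cspan (insert e0 E)"
      using \<open>cspan B \<subseteq> _\<close> complex_vector.span_superset[of B] by blast
    moreover have "insert e0 E \<subseteq> cspan (insert v B)"
    proof -
      have "cspan B \<subseteq> cspan (insert v B)" by (intro complex_vector.span_mono) blast
      moreover from this have "e0 \<in> cspan (insert v B)"
        unfolding e0_def u_def using dB
        by (intro complex_vector.span_scale complex_vector.span_diff)
          (auto intro: complex_vector.span_base[of v])
      ultimately show ?thesis using onb_mem[OF E] by blast
    qed
    ultimately have "cspan (insert e0 E) = cspan (insert v B)"
      by (simp add: complex_vector.span_eq)
    then have "onb (insert e0 E) (cspan (insert v B))"
      using E e0 e0E by (auto simp: onb_def)
    then show ?thesis by blast
  qed
qed

text \<open>Used to give every subspace met below an orthonormal basis, and so a well-defined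
  projection: an independent subset of \<open>N\<close> lies in the span of the finite set
  \<open>E\<close>, so it is finite.\<close>

lemma onb_exists_subspace:
  assumes "onb E M" "csubspace N" "N \<subseteq> M"
  shows "\<exists>F. onb F N"
proof -
  obtain B where B: "B \<subseteq> N" "complex_vector.independent B" "N \<subseteq> cspan B"
    using complex_vector.maximal_independent_subset[of N] by blast
  have "finite B"
    using complex_vector.independent_span_bound[of E B] assms B
    by (metis onb_finite onb_span order_trans)
  moreover have "cspan B = N" using B assms(2) complex_vector.span_minimal by blast
  ultimately show ?thesis using onb_exists by blast
qed

section \<open>Orthogonal projections\<close>

lemma proj_eqI:
  assumes "csubspace S" "p \<in> S" "\<And>y. y \<in> S \<Longrightarrow> cinner (x - p) y = 0"
  shows "proj S x = p"
  unfolding proj_def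
proof (rule the_equality)
  show "p \<in> S \<and> (\<forall>y\<in>S. cinner (x - p) y = 0)" using assms by blast
  fix q assume q: "q \<in> S \<and> (\<forall>y\<in>S. cinner (x - q) y = 0)"
  \<comment> \<open>\<open>proj\<close> is a definite description; two candidates differ by a vector
    of \<open>S\<close> that is orthogonal to itself.\<close>
  then have "p - q \<in> S" using assms complex_vector.subspace_diff by blast
  then have "cinner (x - q) (p - q) = 0" "cinner (x - p) (p - q) = 0" using q assms by blast+
  then have "cinner (p - q) (p - q) = 0" by (simp add: cinner_diff_left)
  then show "q = p" by simp
qed

lemma proj_eq_diag_op:
  assumes "onb E S"
  shows "proj S x = diag_op E (\<lambda>_. 1) x"
proof (rule proj_eqI[OF onb_subspace[OF assms] diag_op_in[OF assms]])
  show "cinner (x - diag_op E (\<lambda>_. 1) x) y = 0" if "y \<in> S" for y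
    by (rule onb_orthogonal_all[OF assms that]) (simp add: cinner_diff_left cinner_diag_op_basis[OF assms])
qed

lemma proj_in: "onb E S \<Longrightarrow> proj S x \<in> S"
  by (simp add: proj_eq_diag_op diag_op_in)

lemma proj_orthogonal:
  assumes "onb E S" "y \<in> S"
  shows "cinner (x - proj S x) y = 0"
  by (rule onb_orthogonal_all[OF assms])
    (simp add: proj_eq_diag_op[OF assms(1)] cinner_diff_left cinner_diag_op_basis[OF assms(1)])

lemma cinner_proj_left: "onb E S \<Longrightarrow> y \<in> S \<Longrightarrow> cinner (proj S x) y = cinner x y"
  using proj_orthogonal[of E S y x] by (simp add: cinner_diff_left)

lemma cinner_proj_right: "onb E S \<Longrightarrow> y \<in> S \<Longrightarrow> cinner y (proj S x) = cinner y x"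
  using cinner_proj_left[of E S y x] cinner_commute[of y x] cinner_commute[of y "proj S x"] by simp

lemma proj_selfadjoint:
  assumes "onb E S"
  shows "cinner (proj S x) y = cinner x (proj S y)"
proof -
  have "cinner (proj S x) y = cinner (proj S x) (proj S y)"
    by (rule cinner_proj_right[OF assms proj_in[OF assms], symmetric])
  also have "\<dots> = cinner x (proj S y)" by (rule cinner_proj_left[OF assms proj_in[OF assms]])
  finally show ?thesis .
qed

lemma proj_id: "onb E S \<Longrightarrow> x \<in> S \<Longrightarrow> proj S x = x"
  by (simp add: proj_eq_diag_op onb_expand)

lemma diag_op_add: "diag_op E \<mu> (x + y) = diag_op E \<mu> x + diag_op E \<mu> y"
  by (simp add: diag_op_def cinner_add_left distrib_left scaleC_add_left sum.distrib)

lemma diag_op_scaleC: "diag_op E \<mu> (c *\<^sub>C x) = c *\<^sub>C diag_op E \<mu> x"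
  by (simp add: diag_op_def cinner_scaleC_left complex_vector.scale_sum_right scaleC_scaleC mult.left_commute)

lemma norm_proj_perp:
  assumes "onb E S"
  shows "(norm x)\<^sup>2 = (norm (proj S x))\<^sup>2 + (norm (x - proj S x))\<^sup>2"
proof -
  have "cinner (proj S x) (x - proj S x) = 0"
    by (subst cinner_eq_0_commute) (rule proj_orthogonal[OF assms proj_in[OF assms]])
  then show ?thesis using norm_Pythagoras[of "proj S x" "x - proj S x"] by simp
qed

lemma norm_proj_le: "onb E S \<Longrightarrow> norm (proj S x) \<le> norm x"
  using norm_proj_perp[of E S x] by (simp add: power2_le_imp_le)

section \<open>Diagonalisation of self-adjoint operators\<close>

lemma operator_on_in: "operator_on M T \<Longrightarrow> x \<in> M \<Longrightarrow> T x \<in> M"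
  and operator_on_add: "operator_on M T \<Longrightarrow> x \<in> M \<Longrightarrow> y \<in> M \<Longrightarrow> T (x + y) = T x + T y"
  and operator_on_scaleC: "operator_on M T \<Longrightarrow> x \<in> M \<Longrightarrow> T (c *\<^sub>C x) = c *\<^sub>C T x"
  by (simp_all add: operator_on_def)

lemma operator_on_zero:
  assumes "operator_on M T" "csubspace M"
  shows "T 0 = 0"
  using operator_on_scaleC[OF assms(1) complex_vector.subspace_0[OF assms(2)], of 0] by simp

lemma operator_on_sum:
  assumes "operator_on M T" "csubspace M" "\<And>i. i \<in> I \<Longrightarrow> f i \<in> M"
  shows "T (\<Sum>i\<in>I. f i) = (\<Sum>i\<in>I. T (f i))"
  using assms(3)
proof (induction I rule: infinite_finite_induct)
  case (insert i I)
  then have "sum f I \<in> M" using assms(2) by (simp add: complex_vector.subspace_sum)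
  with insert show ?case by (simp add: operator_on_add[OF assms(1)])
qed (simp_all add: operator_on_zero[OF assms(1,2)])

lemma operator_on_funpow_in: "operator_on M T \<Longrightarrow> x \<in> M \<Longrightarrow> (T ^^ i) x \<in> M"
  by (induction i) (simp_all add: operator_on_in)

section \<open>Polynomials in an operator and existence of eigenvectors\<close>

definition poly_op :: "('h::complex_hilbert \<Rightarrow> 'h) \<Rightarrow> complex poly \<Rightarrow> 'h \<Rightarrow> 'h" where
  "poly_op T p x = (\<Sum>i\<le>degree p. coeff p i *\<^sub>C (T ^^ i) x)"

lemma poly_op_altdef:
  assumes "degree p \<le> n"
  shows "poly_op T p x = (\<Sum>i\<le>n. coeff p i *\<^sub>C (T ^^ i) x)"
  unfolding poly_op_def using assms
  by (intro sum.mono_neutral_left) (auto simp: coeff_eq_0)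

lemma poly_op_in:
  assumes "operator_on M T" "csubspace M" "x \<in> M"
  shows "poly_op T p x \<in> M"
  unfolding poly_op_def using assms
  by (intro complex_vector.subspace_sum complex_vector.subspace_scale operator_on_funpow_in)

text \<open>Serves to turn roots into eigenvectors: if the product annihilates \<open>x\<close>,
  then \<open>poly_op T q x\<close> lies in the kernel of \<open>T - z\<close>.\<close>

lemma poly_op_linear_factor:
  assumes "operator_on M T" "csubspace M" "x \<in> M"
  shows "poly_op T ([:-z, 1:] * q) x = T (poly_op T q x) - z *\<^sub>C poly_op T q x"
proof -
  define n where "n = degree q"
  have "degree ([:-z, 1:] * q) \<le> Suc n"
    using degree_mult_le[of "[:-z, 1:]" q] by (simp add: n_def)
  then have "poly_op T ([:-z, 1:] * q) x = (\<Sum>i\<le>Suc n. coeff ([:-z, 1:] * q) i *\<^sub>C (T ^^ i) x)"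
    by (rule poly_op_altdef)
  \<comment> \<open>The product is \<open>pCons 0 q\<close> minus \<open>z\<close> times
    \<open>q\<close>. Both parts may run up to \<open>Suc n\<close>, since the coefficient of
    \<open>q\<close> there is 0.\<close>
  also have "\<dots> = (\<Sum>i\<le>Suc n. coeff (pCons 0 q) i *\<^sub>C (T ^^ i) x - z *\<^sub>C (coeff q i *\<^sub>C (T ^^ i) x))"
    by (intro sum.cong refl)
      (simp add: complex_vector.scale_left_diff_distrib scaleC_scaleC flip: complex_vector.scale_left_diff_distrib)
  also have "\<dots> = (\<Sum>i\<le>Suc n. coeff (pCons 0 q) i *\<^sub>C (T ^^ i) x)
      - z *\<^sub>C (\<Sum>i\<le>Suc n. coeff q i *\<^sub>C (T ^^ i) x)"
    by (simp only: sum_subtractf complex_vector.scale_sum_right)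
  also have "(\<Sum>i\<le>Suc n. coeff q i *\<^sub>C (T ^^ i) x) = poly_op T q x"
    by (rule poly_op_altdef[symmetric]) (simp add: n_def)
  also have "(\<Sum>i\<le>Suc n. coeff (pCons 0 q) i *\<^sub>C (T ^^ i) x) = (\<Sum>i\<le>n. coeff q i *\<^sub>C T ((T ^^ i) x))"
    by (subst sum.atMost_Suc_shift) simp
  also have "\<dots> = (\<Sum>i\<le>n. T (coeff q i *\<^sub>C (T ^^ i) x))"
    using assms by (simp add: operator_on_scaleC operator_on_funpow_in)
  also have "\<dots> = T (poly_op T q x)"
    unfolding poly_op_def n_def using assms
    by (intro operator_on_sum[symmetric]) (auto intro: complex_vector.subspace_scale operator_on_funpow_in)
  finally show ?thesis .
qed

text \<open>The \<open>card B + 1\<close> iterates \<open>(T ^^ i) x\<close> lie in the span of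
  \<open>card B\<close> vectors; a linear relation among them is the polynomial.\<close>

lemma annihilating_poly_exists:
  assumes "operator_on M T" "finite B" "M \<subseteq> cspan B" "x \<in> M"
  shows "\<exists>p. p \<noteq> 0 \<and> poly_op T p x = 0"
proof (cases "inj_on (\<lambda>i. (T ^^ i) x) {..card B}")
  case True
  define S where "S = (\<lambda>i. (T ^^ i) x) ` {..card B}"
  have "card S = Suc (card B)" using True by (simp add: S_def card_image)
  moreover have "S \<subseteq> cspan B" using assms operator_on_funpow_in by (fastforce simp: S_def)
  ultimately have "complex_vector.dependent S"
    using complex_vector.independent_span_bound[OF assms(2), of S] by auto
  then obtain u v where u: "v \<in> S" "u v \<noteq> 0" "(\<Sum>v\<in>S. u v *\<^sub>C v) = 0"
    using complex_vector.dependent_finite[of S] by (auto simp: S_def)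
  define p where "p = (\<Sum>i\<le>card B. monom (u ((T ^^ i) x)) i)"
  have coeff_p: "coeff p j = (if j \<le> card B then u ((T ^^ j) x) else 0)" for j
    by (simp add: p_def coeff_sum)
  then have "p \<noteq> 0" using u(1,2) by (auto simp: S_def poly_eq_iff)
  moreover have "degree p \<le> card B" by (rule degree_le) (simp add: coeff_p)
  then have "poly_op T p x = (\<Sum>i\<le>card B. u ((T ^^ i) x) *\<^sub>C (T ^^ i) x)"
    by (simp add: poly_op_altdef coeff_p)
  then have "poly_op T p x = 0"
    using u(3) True by (simp add: S_def sum.reindex)
  ultimately show ?thesis by blast
next
  case False
  \<comment> \<open>Dependence is a property of the set of iterates and does not see repetitions;
    two equal iterates give a difference of monomials directly.\<close>
  then obtain i j where ij: "i < j" "(T ^^ i) x = (T ^^ j) x"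
    by (auto simp: inj_on_def) (metis linorder_neqE_nat)
  define p where "p = monom (1::complex) i - monom 1 j"
  have "coeff p j \<noteq> 0" using ij by (simp add: p_def)
  then have "p \<noteq> 0" by auto
  moreover have "degree p \<le> j" using ij by (intro degree_le) (simp add: p_def)
  then have "poly_op T p x = 0"
    using ij by (simp add: poly_op_altdef p_def complex_vector.scale_left_diff_distrib sum_subtractf
        if_distrib[of "\<lambda>c. c *\<^sub>C _"] scaleC_one cong: if_cong)
  ultimately show ?thesis by blast
qed

lemma eigenvector_exists:
  assumes T: "operator_on M T" and M: "csubspace M" and B: "finite B" "M \<subseteq> cspan B"
    and x: "x \<in> M" "x \<noteq> 0"
  shows "\<exists>z v. v \<in> M \<and> v \<noteq> 0 \<and> T v = z *\<^sub>C v"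
proof -
  \<comment> \<open>The degree is minimised over all nonzero vectors \<open>y\<close> of
    \<open>M\<close> as well. Splitting off a root \<open>z\<close> of a minimal \<open>p\<close>
    leaves a \<open>q\<close> of smaller degree, which cannot annihilate \<open>y\<close>, so
    \<open>poly_op T q y\<close> is an eigenvector for \<open>z\<close>.\<close>
  define P where "P n \<longleftrightarrow> (\<exists>p y. p \<noteq> 0 \<and> degree p = n \<and> y \<in> M \<and> y \<noteq> 0 \<and> poly_op T p y = 0)" for n
  have "\<exists>n. P n" using annihilating_poly_exists[OF T B x(1)] x by (auto simp: P_def)
  then have "P (LEAST n. P n)" by (rule LeastI_ex)
  then obtain p y where p: "p \<noteq> 0" "degree p = (LEAST n. P n)" "y \<in> M" "y \<noteq> 0" "poly_op T p y = 0"
    by (auto simp: P_def)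
  have "degree p \<noteq> 0"
  proof
    assume "degree p = 0"
    then have "coeff p 0 \<noteq> 0" "poly_op T p y = coeff p 0 *\<^sub>C y"
      using p(1) by (auto simp: poly_op_def leading_coeff_neq_0 dest: leading_coeff_neq_0)
    then show False using p by (simp add: complex_vector.scale_eq_0_iff)
  qed
  then obtain z where "poly p z = 0"
    using fundamental_theorem_of_algebra[of p] by (auto simp: constant_degree)
  then obtain q where q: "p = [:-z, 1:] * q" by (auto simp: poly_eq_0_iff_dvd elim: dvdE)
  have "q \<noteq> 0" using q p(1) by auto
  then have "degree q < degree p" unfolding q by (subst degree_mult_eq) auto
  then have "\<not> P (degree q)" using p(2) not_less_Least by metis
  then have "poly_op T q y \<noteq> 0" using \<open>q \<noteq> 0\<close> p by (auto simp: P_def)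
  moreover have "T (poly_op T q y) = z *\<^sub>C poly_op T q y"
    using poly_op_linear_factor[OF T M p(3), of z q] p(5) q by simp
  ultimately show ?thesis using poly_op_in[OF T M p(3)] by blast
qed

lemma orthonormal_independent:
  assumes "finite E" "\<And>x y. x \<in> E \<Longrightarrow> y \<in> E \<Longrightarrow> cinner x y = (if x = y then 1 else 0)"
  shows "complex_vector.independent E"
proof (rule complex_vector.independent_if_scalars_zero[OF assms(1)])
  fix f x assume f: "(\<Sum>x\<in>E. f x *\<^sub>C x) = 0" and x: "x \<in> E"
  have "0 = cinner (\<Sum>x\<in>E. f x *\<^sub>C x) x" using f by simp
  also have "\<dots> = (\<Sum>y\<in>E. f y * cinner y x)" by (simp add: cinner_sum_left cinner_scaleC_left)
  also have "\<dots> = (\<Sum>y\<in>E. if y = x then f x else 0)"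
    using x assms(2) by (intro sum.cong) auto
  finally show "f x = 0" using x assms(1) by simp
qed

text \<open>A largest orthonormal set of eigenvectors must span \<open>M\<close>: self-adjointness
  makes its orthogonal complement \<open>N\<close> invariant, so a nonzero \<open>N\<close> would
  contain a further eigenvector.\<close>

lemma spectral_theorem:
  assumes F: "onb F M" and T: "selfadjoint_on M T"
  shows "\<exists>E l. onb E M \<and> (\<forall>e\<in>E. T e = complex_of_real (l e) *\<^sub>C e)"
proof -
  have op: "operator_on M T" and sa: "\<And>x y. x \<in> M \<Longrightarrow> y \<in> M \<Longrightarrow> cinner (T x) y = cinner x (T y)"
    using T by (auto simp: selfadjoint_on_def)
  have M: "csubspace M" by (rule onb_subspace[OF F])
  define P where "P E \<longleftrightarrow> finite E \<and> E \<subseteq> M \<and> (\<forall>x\<in>E. \<forall>y\<in>E. cinner x y = (if x = y then 1 else 0)) \<and>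
    (\<forall>e\<in>E. \<exists>r. T e = complex_of_real r *\<^sub>C e)" for E
  \<comment> \<open>Orthonormal sets are independent, which bounds their size and makes a largest
    one exist.\<close>
  have "card E \<le> card F" if "P E" for E
  proof -
    have "E \<subseteq> cspan F" using that onb_span[OF F] by (simp add: P_def)
    moreover have "complex_vector.independent E" using that unfolding P_def by (intro orthonormal_independent) blast+
    ultimately show ?thesis using complex_vector.independent_span_bound[OF onb_finite[OF F], of E] by blast
  qed
  moreover have "P {}" by (simp add: P_def)
  ultimately have "\<exists>E. P E \<and> (\<forall>E'. P E' \<longrightarrow> card E' \<le> card E)"
    by (intro ex_has_greatest_nat[of P "{}" card "Suc (card F)"]) (simp_all add: less_Suc_eq_le)
  then obtain E where PE: "P E" and max: "\<And>E'. P E' \<Longrightarrow> card E' \<le> card E" by blast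
  have E: "finite E" "E \<subseteq> M" "\<And>x y. x \<in> E \<Longrightarrow> y \<in> E \<Longrightarrow> cinner x y = (if x = y then 1 else 0)"
    "\<And>e. e \<in> E \<Longrightarrow> \<exists>r. T e = complex_of_real r *\<^sub>C e"
    using PE by (auto simp: P_def)
  have onbE: "onb E (cspan E)" using E by (simp add: onb_def)
  define N where "N = {x \<in> M. \<forall>e\<in>E. cinner x e = 0}"
  have N: "csubspace N" "N \<subseteq> cspan F"
    using M onb_span[OF F]
    by (auto simp: N_def complex_vector.subspace_def cinner_add_left cinner_scaleC_left)
  have opN: "operator_on N T"
  proof -
    have "T x \<in> N" if "x \<in> N" for x
    proof -
      have "cinner (T x) e = 0" if "e \<in> E" for e
      proof -
        obtain r where "T e = complex_of_real r *\<^sub>C e" using E(4) \<open>e \<in> E\<close> by blast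
        then have "cinner (T x) e = cinner x (complex_of_real r *\<^sub>C e)"
          using sa[of x e] \<open>x \<in> N\<close> \<open>e \<in> E\<close> E(2) by (auto simp: N_def)
        then show ?thesis using \<open>x \<in> N\<close> \<open>e \<in> E\<close> by (simp add: cinner_scaleC_right N_def)
      qed
      then show ?thesis using that op by (auto simp: N_def operator_on_in)
    qed
    then show ?thesis using op by (auto simp: operator_on_def N_def)
  qed
  have "N \<subseteq> {0}"
  proof (rule ccontr)
    assume "\<not> N \<subseteq> {0}"
    then obtain x where "x \<in> N" "x \<noteq> 0" by auto
    then obtain z v where v: "v \<in> N" "v \<noteq> 0" "T v = z *\<^sub>C v"
      using eigenvector_exists[OF opN N(1) onb_finite[OF F] N(2)] by blast
    have "z * cinner v v = cnj z * cinner v v"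
      using sa[of v v] v by (simp add: N_def cinner_scaleC_left cinner_scaleC_right)
    then have "z = cnj z" using v(2) by simp
    then have "z = complex_of_real (Re z)" by (simp add: complex_eq_iff)
    then have Tv: "T v = complex_of_real (Re z) *\<^sub>C v" using v(3) by simp
    define e0 where "e0 = complex_of_real (1 / norm v) *\<^sub>C v"
    have "cinner e0 e0 = 1"
      unfolding e0_def cinner_scaleC_left cinner_scaleC_right
      using v(2) by (simp add: cinner_self power2_eq_square)
    moreover have "e0 \<in> N" using v(1) N(1) by (simp add: e0_def complex_vector.subspace_scale)
    moreover from this have "e0 \<in> M" "\<And>e. e \<in> E \<Longrightarrow> cinner e0 e = 0 \<and> cinner e e0 = 0"
      using cinner_eq_0_commute[of e0] by (auto simp: N_def)
    moreover have "T e0 = complex_of_real (Re z) *\<^sub>C e0"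
      using v(1) op Tv by (simp add: e0_def operator_on_scaleC N_def scaleC_scaleC mult.commute)
    ultimately have "P (insert e0 E)" "e0 \<notin> E"
      using PE by (auto simp: P_def)
    then show False using max[of "insert e0 E"] E(1) by simp
  qed
  have "M \<subseteq> cspan E"
  proof
    fix x assume x: "x \<in> M"
    have "cspan E \<subseteq> M" using E(2) M by (rule complex_vector.span_minimal)
    then have "x - diag_op E (\<lambda>_. 1) x \<in> M"
      using x M diag_op_in[OF onbE] by (intro complex_vector.subspace_diff) auto
    then have "x - diag_op E (\<lambda>_. 1) x \<in> N"
      by (simp add: N_def cinner_diff_left cinner_diag_op_basis[OF onbE])
    then have "x = diag_op E (\<lambda>_. 1) x" using \<open>N \<subseteq> {0}\<close> by auto
    then show "x \<in> cspan E" using diag_op_in[OF onbE] by metis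
  qed
  then have "cspan E = M" using E(2) M complex_vector.span_minimal by blast
  then have "onb E M" using onbE by simp
  moreover have "\<exists>l. \<forall>e\<in>E. T e = complex_of_real (l e) *\<^sub>C e"
    using E(4) by (intro bchoice) blast
  ultimately show ?thesis by blast
qed

section \<open>Spectrum and exponential of operators diagonal in an orthonormal basis\<close>

lemma operator_on_eq_diag_op:
  assumes "operator_on M T" "onb E M" "\<And>e. e \<in> E \<Longrightarrow> T e = \<mu> e *\<^sub>C e" "x \<in> M"
  shows "T x = diag_op E \<mu> x"
proof -
  have M: "csubspace M" by (rule onb_subspace[OF assms(2)])
  have "T x = T (\<Sum>e\<in>E. cinner x e *\<^sub>C e)"
    using onb_expand[OF assms(2,4)] by (simp add: diag_op_def)
  also have "\<dots> = (\<Sum>e\<in>E. T (cinner x e *\<^sub>C e))"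
    by (rule operator_on_sum[OF assms(1) M]) (simp add: complex_vector.subspace_scale[OF M] onb_mem[OF assms(2)])
  also have "\<dots> = diag_op E \<mu> x"
    unfolding diag_op_def using assms
    by (intro sum.cong refl) (simp add: operator_on_scaleC onb_mem scaleC_scaleC mult.commute)
  finally show ?thesis .
qed

lemma operator_on_diag_op:
  assumes "onb E M"
  shows "operator_on M (diag_op E \<mu>)"
proof -
  have "norm (diag_op E \<mu> x) \<le> (\<Sum>e\<in>E. cmod (\<mu> e)) * norm x" if "x \<in> M" for x
    using assms that
    by (intro norm_diag_op_le[OF assms] member_le_sum sum_nonneg) (auto simp: onb_finite)
  then show ?thesis using assms
    by (auto simp: operator_on_def diag_op_in diag_op_add diag_op_scaleC)
qed

lemma diag_op_diff_const:
  assumes "onb E M" "x \<in> M"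
  shows "diag_op E (\<lambda>e. \<mu> e - z) x = diag_op E \<mu> x - z *\<^sub>C x"
proof -
  have "z *\<^sub>C x = z *\<^sub>C diag_op E (\<lambda>_. 1) x" by (simp add: onb_expand[OF assms])
  then show ?thesis
    by (simp add: diag_op_def complex_vector.scale_sum_right scaleC_scaleC left_diff_distrib
        complex_vector.scale_left_diff_distrib sum_subtractf)
qed

text \<open>Away from the eigenvalues, the diagonal operator with entries
  \<open>inverse (\<mu> e - z)\<close> inverts \<open>T - z\<close> on \<open>M\<close>; at an
  eigenvalue, an inverse \<open>R\<close> would send 0 to the eigenvector \<open>e\<close>.\<close>

lemma spectrum_on_diagonal:
  assumes T: "operator_on M T" and E: "onb E M" and eig: "\<And>e. e \<in> E \<Longrightarrow> T e = \<mu> e *\<^sub>C e"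
  shows "spectrum_on M T = \<mu> ` E"
proof (intro equalityI subsetI)
  fix z assume z: "z \<in> spectrum_on M T"
  show "z \<in> \<mu> ` E"
  proof (rule ccontr)
    assume nz: "z \<notin> \<mu> ` E"
    then have nz_diff: "\<mu> e - z \<noteq> 0" if "e \<in> E" for e using that by auto
    define R where "R = diag_op E (\<lambda>e. inverse (\<mu> e - z))"
    have Tz: "T x - z *\<^sub>C x = diag_op E (\<lambda>e. \<mu> e - z) x" if "x \<in> M" for x
      using operator_on_eq_diag_op[OF T E eig that] diag_op_diff_const[OF E that] by simp
    have R: "operator_on M R" unfolding R_def by (rule operator_on_diag_op[OF E])
    have "R (T x - z *\<^sub>C x) = x" "T (R x) - z *\<^sub>C R x = x" if x: "x \<in> M" for x
    proof -
      have "diag_op E (\<lambda>e. inverse (\<mu> e - z) * (\<mu> e - z)) x = diag_op E (\<lambda>_. 1) x"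
           "diag_op E (\<lambda>e. (\<mu> e - z) * inverse (\<mu> e - z)) x = diag_op E (\<lambda>_. 1) x"
        using nz_diff by (auto intro!: diag_op_cong)
      then show "R (T x - z *\<^sub>C x) = x" "T (R x) - z *\<^sub>C R x = x"
        using Tz[OF x] Tz[OF operator_on_in[OF R x]] onb_expand[OF E x]
        by (simp_all add: R_def diag_op_diag_op[OF E])
    qed
    then show False using z R unfolding spectrum_on_def by blast
  qed
next
  fix z assume "z \<in> \<mu> ` E"
  then obtain e where e: "e \<in> E" "z = \<mu> e" by blast
  show "z \<in> spectrum_on M T"
    unfolding spectrum_on_def
  proof (intro CollectI notI)
    assume "\<exists>R. operator_on M R \<and> (\<forall>x\<in>M. R (T x - z *\<^sub>C x) = x \<and> T (R x) - z *\<^sub>C R x = x)"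
    then obtain R where R: "operator_on M R" "\<And>x. x \<in> M \<Longrightarrow> R (T x - z *\<^sub>C x) = x" by blast
    have "e = R 0" using R(2)[OF onb_mem[OF E e(1)]] eig[OF e(1)] e(2) by simp
    then have "e = 0" using operator_on_zero[OF R(1) onb_subspace[OF E]] by simp
    then show False using onb_norm[OF E e(1)] by simp
  qed
qed

lemma min_spectral_diagonal:
  assumes T: "operator_on M T" and E: "onb E M" and eig: "\<And>e. e \<in> E \<Longrightarrow> T e = complex_of_real (l e) *\<^sub>C e"
    and "E \<noteq> {}"
  shows "min_spectral M T = Min (l ` E)"
proof -
  have "complex_of_real r \<in> spectrum_on M T \<longleftrightarrow> r \<in> l ` E" for r
    using spectrum_on_diagonal[OF T E eig] by auto
  then show ?thesis
    unfolding min_spectral_def using onb_finite[OF E] \<open>E \<noteq> {}\<close>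
    by (intro Least_equality) auto
qed

text \<open>Polarisation: the quadratic form is real at \<open>x + y\<close> and at
  \<open>x + \<i> *\<^sub>C y\<close>, which relates the imaginary and the real parts of
  \<open>cinner (T x) y\<close> and \<open>cinner (T y) x\<close>.\<close>

lemma positive_on_imp_selfadjoint_on:
  assumes "positive_on M T" "csubspace M"
  shows "selfadjoint_on M T"
proof -
  have T: "operator_on M T" and pos: "\<And>x. x \<in> M \<Longrightarrow> Im (cinner (T x) x) = 0"
    using assms(1) by (auto simp: positive_on_def complex_nonneg_Reals_iff)
  have "cinner (T x) y = cinner x (T y)" if xy: "x \<in> M" "y \<in> M" for x y
  proof -
    have iy: "\<i> *\<^sub>C y \<in> M" using xy assms(2) by (simp add: complex_vector.subspace_scale)
    have "Im (cinner (T (x + y)) (x + y)) = 0" "Im (cinner (T (x + \<i> *\<^sub>C y)) (x + \<i> *\<^sub>C y)) = 0"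
      using xy iy assms(2) by (simp_all add: pos complex_vector.subspace_add)
    then have "Im (cinner (T x) y) + Im (cinner (T y) x) = 0" "Re (cinner (T y) x) - Re (cinner (T x) y) = 0"
      using xy iy
      by (simp_all add: operator_on_add[OF T] operator_on_scaleC[OF T] cinner_add_left cinner_add_right
          cinner_scaleC_left cinner_scaleC_right pos)
    then have "cinner (T x) y = cnj (cinner (T y) x)" by (simp add: complex_eq_iff)
    then show ?thesis using cinner_commute[of x "T y"] by simp
  qed
  then show ?thesis using T by (simp add: selfadjoint_on_def)
qed

lemma exp_op_diagonal:
  assumes T: "operator_on M T" and E: "onb E M" and eig: "\<And>e. e \<in> E \<Longrightarrow> T e = \<mu> e *\<^sub>C e"
    and x: "x \<in> M"
  shows "exp_op T x = diag_op E (\<lambda>e. exp (\<mu> e)) x"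
proof -
  have pow: "(T ^^ m) x = diag_op E (\<lambda>e. \<mu> e ^ m) x" for m
  proof (induction m)
    case 0
    show ?case by (simp add: onb_expand[OF E x])
  next
    case (Suc m)
    have "(T ^^ Suc m) x = T (diag_op E (\<lambda>e. \<mu> e ^ m) x)" using Suc by simp
    also have "\<dots> = diag_op E \<mu> (diag_op E (\<lambda>e. \<mu> e ^ m) x)"
      by (rule operator_on_eq_diag_op[OF T E eig diag_op_in[OF E]])
    finally show ?case by (simp add: diag_op_diag_op[OF E])
  qed
  \<comment> \<open>On each basis vector the series is the scalar exponential series, carried along
    the bounded linear map from scalars to multiples of \<open>e\<close>; the basis is finite, so
    the sums can be added.\<close>
  have "(\<lambda>m. (\<mu> e ^ m /\<^sub>R fact m * cinner x e) *\<^sub>C e) sums ((exp (\<mu> e) * cinner x e) *\<^sub>C e)" for e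
    by (intro bounded_linear.sums[OF bounded_linear_scaleC_left] sums_mult2 exp_converges)
  then have "(\<lambda>m. \<Sum>e\<in>E. (\<mu> e ^ m /\<^sub>R fact m * cinner x e) *\<^sub>C e) sums diag_op E (\<lambda>e. exp (\<mu> e)) x"
    unfolding diag_op_def by (intro sums_sum)
  moreover have "(\<Sum>e\<in>E. (\<mu> e ^ m /\<^sub>R fact m * cinner x e) *\<^sub>C e) = (T ^^ m) x /\<^sub>R fact m" for m
    by (simp add: pow diag_op_def complex_vector.scale_sum_right scaleR_eq_scaleC scaleC_scaleC scaleR_conv_of_real mult.assoc)
  ultimately show ?thesis by (simp add: exp_op_def sums_iff)
qed

section \<open>Pairs of subspaces\<close>

lemma proj_add: "onb E S \<Longrightarrow> proj S (x + y) = proj S x + proj S y"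
  by (simp add: proj_eq_diag_op diag_op_add)

lemma proj_scaleC: "onb E S \<Longrightarrow> proj S (c *\<^sub>C x) = c *\<^sub>C proj S x"
  by (simp add: proj_eq_diag_op diag_op_scaleC)

lemma operator_on_proj_proj:
  assumes "onb E S" "onb F T" "S \<subseteq> M"
  shows "operator_on M (proj S \<circ> proj T)"
proof -
  have "norm (proj S (proj T x)) \<le> 1 * norm x" for x
    using norm_proj_le[OF assms(1), of "proj T x"] norm_proj_le[OF assms(2), of x] by simp
  moreover have "proj S x \<in> M" for x using proj_in[OF assms(1)] assms(3) by blast
  ultimately show ?thesis
    unfolding operator_on_def using assms by (auto simp: proj_add proj_scaleC intro: exI[of _ 1])
qed

section \<open>Operator norms on a subspace\<close>

lemma opnorm_on_le:
  assumes "csubspace M" "0 \<le> C" "\<And>x. x \<in> M \<Longrightarrow> norm (T x) \<le> C * norm x"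
  shows "opnorm_on M T \<le> C"
  unfolding opnorm_on_def
proof (rule cSUP_least)
  show "{x \<in> M. norm x \<le> 1} \<noteq> {}" using complex_vector.subspace_0[OF assms(1)] by force
  fix x assume "x \<in> {x \<in> M. norm x \<le> 1}"
  then show "norm (T x) \<le> C"
    using assms(3)[of x] mult_left_mono[OF _ assms(2), of "norm x" 1] by simp
qed

lemma norm_le_opnorm_on_unit:
  assumes "operator_on M T" "x \<in> M" "norm x \<le> 1"
  shows "norm (T x) \<le> opnorm_on M T"
  unfolding opnorm_on_def
proof (rule cSUP_upper)
  obtain C where C: "\<And>x. x \<in> M \<Longrightarrow> norm (T x) \<le> C * norm x"
    using assms(1) unfolding operator_on_def by blast
  show "bdd_above ((\<lambda>x. norm (T x)) ` {x \<in> M. norm x \<le> 1})"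
  proof (rule bdd_aboveI2[where M = "max 0 C"])
    fix x assume x: "x \<in> {x \<in> M. norm x \<le> 1}"
    then have "norm (T x) \<le> C * norm x" by (simp add: C)
    also have "\<dots> \<le> max 0 C * 1" using x by (intro mult_mono) auto
    finally show "norm (T x) \<le> max 0 C" by simp
  qed
qed (use assms in simp)

lemma opnorm_on_nonneg: "operator_on M T \<Longrightarrow> csubspace M \<Longrightarrow> 0 \<le> opnorm_on M T"
  using norm_le_opnorm_on_unit[of M T 0] by (simp add: complex_vector.subspace_0 operator_on_zero)

lemma norm_le_opnorm_on:
  assumes "operator_on M T" "csubspace M" "x \<in> M"
  shows "norm (T x) \<le> opnorm_on M T * norm x"
proof (cases "x = 0")
  case False
  let ?c = "complex_of_real (1 / norm x)"
  have "norm (T (?c *\<^sub>C x)) \<le> opnorm_on M T"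
    using assms False
    by (intro norm_le_opnorm_on_unit) (auto simp: norm_scaleC complex_vector.subspace_scale norm_divide)
  then show ?thesis
    using False assms by (simp add: operator_on_scaleC norm_scaleC norm_divide field_simps)
qed (simp add: operator_on_zero[OF assms(1,2)])

lemma opnorm_on_cong: "(\<And>x. x \<in> M \<Longrightarrow> f x = g x) \<Longrightarrow> opnorm_on M f = opnorm_on M g"
  unfolding opnorm_on_def by (intro SUP_cong) auto

section \<open>Orthogonal complements inside a subspace\<close>

lemma ocompl_subspace: "csubspace M \<Longrightarrow> csubspace (ocompl M S)"
  by (auto simp: ocompl_def complex_vector.subspace_def cinner_add_left cinner_scaleC_left)

lemma proj_perp_in_ocompl:
  assumes "onb E S" "csubspace M" "S \<subseteq> M" "x \<in> M"
  shows "x - proj S x \<in> ocompl M S"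
  using assms proj_in[OF assms(1), of x] proj_orthogonal[OF assms(1)]
  by (auto simp: ocompl_def intro: complex_vector.subspace_diff)

lemma proj_ocompl:
  assumes "onb E S" "csubspace M" "S \<subseteq> M" "x \<in> M"
  shows "proj (ocompl M S) x = x - proj S x"
proof (rule proj_eqI[OF ocompl_subspace[OF assms(2)] proj_perp_in_ocompl[OF assms]])
  fix y assume "y \<in> ocompl M S"
  then have "cinner y (proj S x) = 0" using proj_in[OF assms(1)] by (simp add: ocompl_def)
  then show "cinner (x - (x - proj S x)) y = 0" by (subst cinner_eq_0_commute) simp
qed

lemma ocompl_ocompl:
  assumes "onb E S" "csubspace M" "S \<subseteq> M"
  shows "ocompl M (ocompl M S) = S"
proof (intro equalityI subsetI)
  fix x assume x: "x \<in> ocompl M (ocompl M S)"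
  then have perp: "x - proj S x \<in> ocompl M S"
    by (intro proj_perp_in_ocompl[OF assms]) (simp add: ocompl_def)
  then have "cinner x (x - proj S x) = 0" using x by (simp add: ocompl_def)
  moreover have "cinner (x - proj S x) (proj S x) = 0"
    by (rule proj_orthogonal[OF assms(1) proj_in[OF assms(1)]])
  then have "cinner (proj S x) (x - proj S x) = 0" by (subst cinner_eq_0_commute)
  ultimately have "cinner (x - proj S x) (x - proj S x) = 0" by (simp add: cinner_diff_left)
  then have "x = proj S x" by simp
  then show "x \<in> S" using proj_in[OF assms(1)] by metis
next
  fix x assume x: "x \<in> S"
  then have "cinner x y = 0" if "y \<in> ocompl M S" for y
    using that cinner_eq_0_commute[of x y] by (simp add: ocompl_def)
  then show "x \<in> ocompl M (ocompl M S)" using x assms(3) by (auto simp: ocompl_def[of M "ocompl M S"])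
qed

lemma cmod_cinner_self: "cmod (cinner x x) = (norm (x::'h::complex_hilbert))\<^sup>2"
  by (simp only: cinner_self norm_of_real) simp

text \<open>The two products are adjoint to each other. One inequality suffices, since exchanging
  \<open>S\<close> and \<open>T\<close> gives the other.\<close>

lemma opnorm_proj_proj_commute_le:
  assumes "onb E S" "onb F T" "S \<subseteq> M" "T \<subseteq> M" "csubspace M"
  shows "opnorm_on M (proj S \<circ> proj T) \<le> opnorm_on M (proj T \<circ> proj S)"
proof -
  let ?s = "opnorm_on M (proj T \<circ> proj S)"
  have op: "operator_on M (proj T \<circ> proj S)" by (rule operator_on_proj_proj[OF assms(2,1,4)])
  show ?thesis
  proof (rule opnorm_on_le[OF assms(5) opnorm_on_nonneg[OF op assms(5)]])
    fix x assume x: "x \<in> M"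
    define u where "u = proj S (proj T x)"
    have u: "u \<in> S" unfolding u_def by (rule proj_in[OF assms(1)])
    have "cinner u u = cinner u (proj T x)"
      by (subst (2) u_def) (rule cinner_proj_right[OF assms(1) u])
    also have "\<dots> = cinner (proj T (proj S u)) x"
      by (simp add: proj_selfadjoint[OF assms(2)] proj_id[OF assms(1) u])
    finally have "(norm u)\<^sup>2 = cmod (cinner (proj T (proj S u)) x)"
      by (simp only: cmod_cinner_self[symmetric])
    also have "\<dots> \<le> norm (proj T (proj S u)) * norm x" by (rule cinner_Cauchy_Schwarz)
    also have "norm (proj T (proj S u)) \<le> ?s * norm u"
      using norm_le_opnorm_on[OF op assms(5), of u] u assms(3) by auto
    finally have "norm u * norm u \<le> norm u * (?s * norm x)"
      by (simp add: power2_eq_square mult_right_mono ac_simps)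
    then show "norm ((proj S \<circ> proj T) x) \<le> ?s * norm x"
      using opnorm_on_nonneg[OF op assms(5)] by (cases "u = 0") (simp_all add: u_def)
  qed
qed

text \<open>The component of \<open>x\<close> orthogonal to \<open>S + T\<close> is orthogonal to
  both subspaces, so \<open>int\<close> forces it to be 0.\<close>

lemma sum_of_subspaces:
  assumes F: "onb F M" and S: "csubspace S" "S \<subseteq> M" and T: "csubspace T" "T \<subseteq> M"
    and int: "ocompl M S \<inter> ocompl M T \<subseteq> {0}" and x: "x \<in> M"
  shows "\<exists>s\<in>S. \<exists>t\<in>T. x = s + t"
proof -
  define N where "N = {s + t | s t. s \<in> S \<and> t \<in> T}"
  have M: "csubspace M" by (rule onb_subspace[OF F])
  have N: "csubspace N" unfolding N_def by (rule complex_vector.subspace_sums[OF S(1) T(1)])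
  have "N \<subseteq> M" using S(2) T(2) M by (auto simp: N_def intro: complex_vector.subspace_add)
  then obtain E where E: "onb E N" using onb_exists_subspace[OF F N] by blast
  have "s + 0 \<in> N" if "s \<in> S" for s using that complex_vector.subspace_0[OF T(1)] unfolding N_def by blast
  moreover have "0 + t \<in> N" if "t \<in> T" for t using that complex_vector.subspace_0[OF S(1)] unfolding N_def by blast
  ultimately have "S \<subseteq> N" "T \<subseteq> N" by auto
  moreover have "x - proj N x \<in> ocompl M N" by (rule proj_perp_in_ocompl[OF E M \<open>N \<subseteq> M\<close> x])
  ultimately have "x - proj N x \<in> ocompl M S \<inter> ocompl M T" unfolding ocompl_def by blast
  then have "x - proj N x = 0" using int by blast
  then have "x \<in> N" using proj_in[OF E, of x] by simp
  then show ?thesis by (auto simp: N_def)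
qed

lemma opnorm_ocompl_le:
  assumes F: "onb F M" and S: "csubspace S" "S \<subseteq> M" and T: "csubspace T" "T \<subseteq> M"
    and int: "ocompl M S \<inter> ocompl M T \<subseteq> {0}"
  shows "opnorm_on M (proj (ocompl M T) \<circ> proj (ocompl M S)) \<le> opnorm_on M (proj S \<circ> proj T)"
proof -
  let ?s = "opnorm_on M (proj S \<circ> proj T)"
  have M: "csubspace M" by (rule onb_subspace[OF F])
  obtain E where E: "onb E S" using onb_exists_subspace[OF F S] by blast
  obtain G where G: "onb G T" using onb_exists_subspace[OF F T] by blast
  have "ocompl M S \<subseteq> M" by (auto simp: ocompl_def)
  then obtain E' where E': "onb E' (ocompl M S)"
    using onb_exists_subspace[OF F ocompl_subspace[OF M]] by blast
  have op: "operator_on M (proj S \<circ> proj T)" by (rule operator_on_proj_proj[OF E G S(2)])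
  have s0: "0 \<le> ?s" by (rule opnorm_on_nonneg[OF op M])
  have s1: "?s \<le> 1"
  proof (rule opnorm_on_le[OF M])
    show "norm ((proj S \<circ> proj T) x) \<le> 1 * norm x" for x
      using norm_proj_le[OF E, of "proj T x"] norm_proj_le[OF G, of x] by simp
  qed simp
  show ?thesis
  proof (rule opnorm_on_le[OF M s0])
    fix y assume "y \<in> M"
    define z where "z = proj (ocompl M S) y"
    have z: "z \<in> ocompl M S" unfolding z_def by (rule proj_in[OF E'])
    then have zM: "z \<in> M" and zS: "\<And>u. u \<in> S \<Longrightarrow> cinner z u = 0" by (auto simp: ocompl_def)
    obtain u x where ux: "u \<in> S" "x \<in> T" "z = u + x"
      using sum_of_subspaces[OF F S T int zM] by blast
    \<comment> \<open>Because \<open>proj S\<close> kills \<open>z\<close>, the summand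
      \<open>u\<close> is forced to be \<open>- proj S x\<close>: thus \<open>z\<close> is the
      component of \<open>x\<close> orthogonal to \<open>S\<close>.\<close>
    have "proj S z = 0"
      using zS complex_vector.subspace_0[OF S(1)] by (intro proj_eqI[OF S(1)]) auto
    then have "u + proj S x = 0"
      using ux(3) proj_add[OF E, of u x] proj_id[OF E ux(1)] by simp
    then have zx: "z = x - proj S x" using ux(3) by (simp add: eq_neg_iff_add_eq_0[symmetric])
    have "(norm x)\<^sup>2 = (norm (proj S x))\<^sup>2 + (norm z)\<^sup>2"
      using norm_proj_perp[OF E, of x] zx by simp
    moreover have "norm (proj S x) \<le> ?s * norm x"
      using norm_le_opnorm_on[OF op M, of x] proj_id[OF G ux(2)] ux(2) T(2) by auto
    then have "(norm (proj S x))\<^sup>2 \<le> (?s * norm x)\<^sup>2" by (rule power_mono) simp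
    \<comment> \<open>Since \<open>x\<close> lies in \<open>T\<close>, \<open>proj S x\<close> is at
      most \<open>?s\<close> times as long; Pythagoras then bounds \<open>z\<close> from below in
      terms of \<open>x\<close>.\<close>
    ultimately have b: "(1 - ?s\<^sup>2) * (norm x)\<^sup>2 \<le> (norm z)\<^sup>2" by (simp add: algebra_simps)
    have "cinner z z = cinner z x"
      by (subst (2) zx) (simp add: cinner_diff_right zS proj_in[OF E])
    also have "\<dots> = cinner (proj T z) x" by (rule cinner_proj_left[OF G ux(2), symmetric])
    finally have "(norm z)\<^sup>2 = cmod (cinner (proj T z) x)"
      by (simp only: cmod_cinner_self[symmetric])
    also have "\<dots> \<le> norm (proj T z) * norm x" by (rule cinner_Cauchy_Schwarz)
    finally have "((norm z)\<^sup>2)\<^sup>2 \<le> (norm (proj T z) * norm x)\<^sup>2" by (rule power_mono) simp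
    \<comment> \<open>The nonnegative factor \<open>1 - ?s\<^sup>2\<close> lets \<open>b\<close>
      eliminate \<open>x\<close>. Cancelling \<open>(norm z)\<^sup>2\<close> leaves a lower bound
      for \<open>proj T z\<close>, hence an upper bound for \<open>z - proj T z\<close>.\<close>
    then have "(1 - ?s\<^sup>2) * ((norm z)\<^sup>2)\<^sup>2 \<le> (1 - ?s\<^sup>2) * ((norm (proj T z))\<^sup>2 * (norm x)\<^sup>2)"
      using s0 s1 by (intro mult_left_mono) (simp_all add: power_mult_distrib power_le_one)
    also have "\<dots> = ((1 - ?s\<^sup>2) * (norm x)\<^sup>2) * (norm (proj T z))\<^sup>2" by simp
    also have "\<dots> \<le> (norm z)\<^sup>2 * (norm (proj T z))\<^sup>2" using b by (rule mult_right_mono) simp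
    finally have "(norm z)\<^sup>2 * ((1 - ?s\<^sup>2) * (norm z)\<^sup>2) \<le> (norm z)\<^sup>2 * (norm (proj T z))\<^sup>2"
      by (simp add: power2_eq_square ac_simps)
    then have "(1 - ?s\<^sup>2) * (norm z)\<^sup>2 \<le> (norm (proj T z))\<^sup>2" by (cases "z = 0") simp_all
    then have "(norm (z - proj T z))\<^sup>2 \<le> (?s * norm z)\<^sup>2"
      using norm_proj_perp[OF G, of z] by (simp add: algebra_simps)
    then have "norm (z - proj T z) \<le> ?s * norm z"
      using s0 by (simp add: power2_le_iff_abs_le)
    also have "\<dots> \<le> ?s * norm y"
      using norm_proj_le[OF E', of y] s0 by (simp add: z_def mult_left_mono)
    finally show "norm ((proj (ocompl M T) \<circ> proj (ocompl M S)) y) \<le> ?s * norm y"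
      using proj_ocompl[OF G M T(2) zM] by (simp add: z_def)
  qed
qed

text \<open>\<open>opnorm_ocompl_le\<close> is applied to \<open>S\<close> and \<open>T\<close>, and
  again to their complements, whose complements are \<open>S\<close> and \<open>T\<close>; each
  application uses one of the two trivial intersections.\<close>

lemma opnorm_ocompl_eq:
  assumes F: "onb F M" and S: "csubspace S" "S \<subseteq> M" and T: "csubspace T" "T \<subseteq> M"
    and "S \<inter> T \<subseteq> {0}" "ocompl M S \<inter> ocompl M T \<subseteq> {0}"
  shows "opnorm_on M (proj (ocompl M S) \<circ> proj (ocompl M T)) = opnorm_on M (proj S \<circ> proj T)"
proof -
  have M: "csubspace M" by (rule onb_subspace[OF F])
  have sub: "ocompl M U \<subseteq> M" for U by (auto simp: ocompl_def)
  obtain E where E: "onb E S" using onb_exists_subspace[OF F S] by blast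
  obtain G where G: "onb G T" using onb_exists_subspace[OF F T] by blast
  obtain E' where E': "onb E' (ocompl M S)"
    using onb_exists_subspace[OF F ocompl_subspace[OF M] sub] by blast
  obtain G' where G': "onb G' (ocompl M T)"
    using onb_exists_subspace[OF F ocompl_subspace[OF M] sub] by blast
  have "opnorm_on M (proj (ocompl M S) \<circ> proj (ocompl M T)) \<le> opnorm_on M (proj (ocompl M T) \<circ> proj (ocompl M S))"
    by (rule opnorm_proj_proj_commute_le[OF E' G' sub sub M])
  also have "\<dots> \<le> opnorm_on M (proj S \<circ> proj T)"
    by (rule opnorm_ocompl_le[OF F S T assms(7)])
  finally have 1: "opnorm_on M (proj (ocompl M S) \<circ> proj (ocompl M T)) \<le> opnorm_on M (proj S \<circ> proj T)" .
  have "opnorm_on M (proj S \<circ> proj T) \<le> opnorm_on M (proj T \<circ> proj S)"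
    by (rule opnorm_proj_proj_commute_le[OF E G S(2) T(2) M])
  also have "\<dots> \<le> opnorm_on M (proj (ocompl M S) \<circ> proj (ocompl M T))"
    using opnorm_ocompl_le[OF F ocompl_subspace[OF M, of S] sub ocompl_subspace[OF M, of T] sub]
      ocompl_ocompl[OF E M S(2)] ocompl_ocompl[OF G M T(2)] assms(6) by simp
  finally show ?thesis using 1 by simp
qed

lemma opnorm_proj_proj_less_1:
  assumes F: "onb F M" and S: "csubspace S" "S \<subseteq> M" and T: "csubspace T" "T \<subseteq> M"
    and int: "S \<inter> T \<subseteq> {0}"
  shows "opnorm_on M (proj S \<circ> proj T) < 1"
proof -
  have M: "csubspace M" by (rule onb_subspace[OF F])
  obtain E where E: "onb E S" using onb_exists_subspace[OF F S] by blast
  obtain G where G: "onb G T" using onb_exists_subspace[OF F T] by blast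
  \<comment> \<open>\<open>Q\<close> is self-adjoint and \<open>cinner (Q x) x\<close> is the
    squared norm of \<open>proj S (proj T x)\<close>, so its largest eigenvalue controls the
    operator norm.\<close>
  define Q where "Q x = proj T (proj S (proj T x))" for x
  have Q_cinner: "cinner (Q x) y = cinner (proj S (proj T x)) (proj S (proj T y))" for x y
  proof -
    have "cinner (Q x) y = cinner (proj S (proj T x)) (proj T y)"
      unfolding Q_def by (rule proj_selfadjoint[OF G])
    then show ?thesis by (simp add: cinner_proj_right[OF E proj_in[OF E]])
  qed
  have "selfadjoint_on M Q"
  proof -
    have "norm (Q x) \<le> 1 * norm x" for x
      using norm_proj_le[OF G, of "proj S (proj T x)"] norm_proj_le[OF E, of "proj T x"]
        norm_proj_le[OF G, of x] by (simp add: Q_def)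
    moreover have "Q x \<in> M" for x using proj_in[OF G] T(2) by (auto simp: Q_def)
    ultimately have "operator_on M Q"
      unfolding operator_on_def
      by (auto simp: Q_def proj_add[OF E] proj_add[OF G] proj_scaleC[OF E] proj_scaleC[OF G] intro!: exI[of _ 1])
    moreover have "cinner (Q x) y = cinner x (Q y)" for x y
      using Q_cinner[of x y] Q_cinner[of y x] cinner_commute[of x "Q y"]
        cinner_commute[of "proj S (proj T x)" "proj S (proj T y)"] by simp
    ultimately show ?thesis by (simp add: selfadjoint_on_def)
  qed
  then obtain B l where B: "onb B M" and l: "\<And>e. e \<in> B \<Longrightarrow> Q e = complex_of_real (l e) *\<^sub>C e"
    using spectral_theorem[OF F] by blast
  have "operator_on M Q" using \<open>selfadjoint_on M Q\<close> by (simp add: selfadjoint_on_def)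
  have l1: "l e < 1" if "e \<in> B" for e
  proof -
    have "complex_of_real (l e) = cinner (Q e) e"
      using l[OF that] onb_cinner[OF B that that] by (simp add: cinner_scaleC_left)
    then have le: "l e = (norm (proj S (proj T e)))\<^sup>2"
      by (simp only: Q_cinner cinner_self of_real_eq_iff)
    have 1: "(norm e)\<^sup>2 = 1" by (simp add: onb_norm[OF B that])
    have *: "1 = (norm (proj T e))\<^sup>2 + (norm (e - proj T e))\<^sup>2"
        "(norm (proj T e))\<^sup>2 = l e + (norm (proj T e - proj S (proj T e)))\<^sup>2"
      using norm_proj_perp[OF G, of e] norm_proj_perp[OF E, of "proj T e"] 1 le by simp_all
    \<comment> \<open>An eigenvalue 1 means that neither projection shortens \<open>e\<close>, which
      puts \<open>e\<close> in \<open>S \<inter> T\<close>.\<close>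
    have "l e \<noteq> 1"
    proof
      assume "l e = 1"
      then have "(norm (e - proj T e))\<^sup>2 = 0" "(norm (proj T e - proj S (proj T e)))\<^sup>2 = 0"
        using * zero_le_power2[of "norm (e - proj T e)"]
          zero_le_power2[of "norm (proj T e - proj S (proj T e))"] by linarith+
      then have "e = proj T e" "e = proj S e" by simp_all
      then have "e \<in> S" "e \<in> T" using proj_in[OF E, of e] proj_in[OF G, of e] by simp_all
      then have "e = 0" using int by blast
      then show False using 1 by simp
    qed
    moreover have "l e \<le> 1"
      using * zero_le_power2[of "norm (e - proj T e)"]
          zero_le_power2[of "norm (proj T e - proj S (proj T e))"] by linarith
    ultimately show ?thesis by simp
  qed
  \<comment> \<open>Finitely many eigenvalues below 1 have a maximum below 1; the inserted 0 covers
    an empty basis and keeps \<open>L\<close> nonnegative for \<open>sqrt\<close>.\<close>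
  define L where "L = Max (insert 0 (l ` B))"
  have L: "0 \<le> L" "L < 1" "\<And>e. e \<in> B \<Longrightarrow> l e \<le> L"
    using l1 onb_finite[OF B] by (auto simp: L_def)
  have "norm ((proj S \<circ> proj T) x) \<le> sqrt L * norm x" if x: "x \<in> M" for x
  proof -
    have "complex_of_real ((norm (proj S (proj T x)))\<^sup>2) = cinner (diag_op B (\<lambda>e. complex_of_real (l e)) x) x"
      using operator_on_eq_diag_op[OF \<open>operator_on M Q\<close> B l x] Q_cinner[of x x] by (simp only: cinner_self)
    also have "\<dots> = complex_of_real (\<Sum>e\<in>B. l e * (cmod (cinner x e))\<^sup>2)"
      unfolding cinner_diag_op of_real_sum of_real_mult complex_norm_square by (simp add: mult.assoc)
    finally have "(norm (proj S (proj T x)))\<^sup>2 = (\<Sum>e\<in>B. l e * (cmod (cinner x e))\<^sup>2)"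
      by (simp only: of_real_eq_iff)
    also have "\<dots> \<le> (\<Sum>e\<in>B. L * (cmod (cinner x e))\<^sup>2)"
      using L by (intro sum_mono mult_right_mono) auto
    also have "\<dots> = (sqrt L * norm x)\<^sup>2"
      using L(1) by (simp add: norm_onb[OF B x] power_mult_distrib sum_distrib_left)
    finally show ?thesis using L(1) by (simp add: power2_le_iff_abs_le)
  qed
  then have "opnorm_on M (proj S \<circ> proj T) \<le> sqrt L"
    using L(1) by (intro opnorm_on_le[OF M]) auto
  also have "\<dots> < 1" using L(2) by simp
  finally show ?thesis .
qed

section \<open>A trigonometric inequality\<close>

text \<open>With \<open>t = 1 - r\<close> the left side is
  \<open>1 - 2 * (sin (t * (pi / 4)))\<^sup>2\<close>, and concavity puts the sine above its chord
  on \<open>{0..pi/4}\<close>. This is the endpoint estimate for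
  \<open>sin_scaled_le\<close>.\<close>

lemma sin_half_pi_le:
  assumes "0 \<le> r" "r \<le> (1::real)"
  shows "sin (r * (pi / 2)) \<le> 1 - (1 - r)\<^sup>2"
proof -
  define t where "t = 1 - r"
  have t: "0 \<le> t" "t \<le> 1" using assms by (simp_all add: t_def)
  have "convex_on {0..pi/4} (\<lambda>y. - sin y)"
    by (rule f''_ge0_imp_convex[where f' = "\<lambda>y. - cos y" and f'' = sin])
      (auto intro!: derivative_eq_intros sin_ge_zero)
  from convex_onD_Icc[OF this _ t] have "t * (sqrt 2 / 2) \<le> sin (t * (pi / 4))"
    by (simp add: sin_45)
  then have "(t * (sqrt 2 / 2))\<^sup>2 \<le> (sin (t * (pi / 4)))\<^sup>2"
    by (rule power_mono) (use t in simp)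
  moreover have "(t * (sqrt 2 / 2))\<^sup>2 = t\<^sup>2 / 2" by (simp add: power_mult_distrib power_divide)
  moreover have "sin (r * (pi / 2)) = 1 - 2 * (sin (t * (pi / 4)))\<^sup>2"
  proof -
    have "r * (pi / 2) = pi / 2 - 2 * (t * (pi / 4))" by (simp add: t_def field_simps)
    then have "sin (r * (pi / 2)) = cos (2 * (t * (pi / 4)))"
      using cos_sin_eq[of "2 * (t * (pi / 4))"] by (simp only: of_real_eq_id id_apply)
    then show ?thesis by (simp only: cos_double_sin)
  qed
  ultimately show ?thesis unfolding t_def[symmetric] by linarith
qed

text \<open>The difference \<open>f\<close> of the two sides is convex on \<open>{0..pi/2}\<close>,
  vanishes at 0 and is nonpositive at \<open>pi / 2\<close>; lying below its chord, it is
  nonpositive throughout.\<close>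

lemma sin_scaled_le:
  assumes r: "0 \<le> r" "r \<le> (1::real)" and l: "0 \<le> l" "l \<le> pi / 2"
  shows "(1 + r\<^sup>2) * sin (r * l) \<le> 2 * r * sin l"
proof -
  define f where "f x = (1 + r\<^sup>2) * sin (r * x) - 2 * r * sin x" for x
  have "convex_on {0..pi/2} f"
    unfolding f_def
  proof (rule f''_ge0_imp_convex[where
        f' = "\<lambda>x. (1 + r\<^sup>2) * (r * cos (r * x)) - 2 * r * cos x" and
        f'' = "\<lambda>x. 2 * r * sin x - (1 + r\<^sup>2) * (r * r * sin (r * x))"])
    fix x :: real assume x: "x \<in> {0..pi/2}"
    have "r * x \<le> 1 * x" using r x by (intro mult_right_mono) auto
    then have "sin (r * x) \<le> sin x" using x r by (intro sin_monotone_2pi_le) (auto intro: order_trans[of _ 0])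
    moreover have "0 \<le> sin (r * x)" using \<open>r * x \<le> 1 * x\<close> x r by (intro sin_ge_zero) auto
    moreover have "(1 + r\<^sup>2) * r \<le> 2 * 1" using r by (intro mult_mono) (auto simp: power_le_one)
    ultimately have "((1 + r\<^sup>2) * r) * sin (r * x) \<le> 2 * sin x" by (intro mult_mono) auto
    then have "r * (((1 + r\<^sup>2) * r) * sin (r * x)) \<le> r * (2 * sin x)" using r by (intro mult_left_mono)
    then show "0 \<le> 2 * r * sin x - (1 + r\<^sup>2) * (r * r * sin (r * x))" by (simp add: ac_simps)
  qed (auto intro!: derivative_eq_intros simp: algebra_simps)
  moreover define t where "t = l / (pi / 2)"
  have t: "0 \<le> t" "t \<le> 1" using l by (simp_all add: t_def)
  ultimately have "f (t * (pi / 2)) \<le> (1 - t) * f 0 + t * f (pi / 2)"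
    using convex_onD_Icc[of 0 "pi/2" f t] by simp
  also have "f 0 = 0" by (simp add: f_def)
  also have "f (pi / 2) \<le> 0"
  proof -
    have "(1 + r\<^sup>2) * sin (r * (pi / 2)) \<le> (1 + r\<^sup>2) * (1 - (1 - r)\<^sup>2)"
      by (intro mult_left_mono sin_half_pi_le r) simp
    also have "\<dots> = 2 * r - r\<^sup>2 * (1 - r)\<^sup>2 - 0"
      by (simp add: power2_eq_square algebra_simps)
    also have "\<dots> \<le> 2 * r" by simp
    finally show ?thesis by (simp add: f_def)
  qed
  then have "(1 - t) * 0 + t * f (pi / 2) \<le> 0" using t by (simp add: mult_nonneg_nonpos)
  finally have "f (t * (pi / 2)) \<le> 0" by simp
  then show ?thesis by (simp add: t_def f_def)
qed

text \<open>
  With \<open>m = sin g / g\<close>, the squared claim is \<open>m (l\<^sup>2 + g\<^sup>2) \<le> 2 l sin l\<close>, which is \<open>sin_scaled_le\<close> at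
  \<open>r = g / l\<close>.
\<close>

lemma cmod_exp_minus_chord_le_aux:
  assumes g: "0 < g" "g \<le> l" "l \<le> pi / 2"
  shows "cmod (exp (\<i> * complex_of_real l) - \<i> * complex_of_real (sin g / g * l)) \<le> cos g"
proof -
  define m where "m = sin g / g"
  have "0 \<le> m" unfolding m_def using g by (intro divide_nonneg_pos sin_ge_zero) auto
  have "(1 + (g / l)\<^sup>2) * sin (g / l * l) \<le> 2 * (g / l) * sin l"
    by (rule sin_scaled_le) (use g in auto)
  then have "(l\<^sup>2 / g) * ((1 + (g / l)\<^sup>2) * sin g) \<le> (l\<^sup>2 / g) * (2 * (g / l) * sin l)"
    using g by (intro mult_left_mono) auto
  moreover have "(l\<^sup>2 / g) * ((1 + (g / l)\<^sup>2) * sin g) = m * (l\<^sup>2 + g\<^sup>2)"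
    using g by (simp add: m_def field_simps power2_eq_square)
  moreover have "(l\<^sup>2 / g) * (2 * (g / l) * sin l) = 2 * l * sin l"
    using g by (simp add: field_simps power2_eq_square)
  ultimately have "m * (m * (l\<^sup>2 + g\<^sup>2)) \<le> m * (2 * l * sin l)"
    using \<open>0 \<le> m\<close> by (intro mult_left_mono) auto
  moreover have "m * g = sin g" using g by (simp add: m_def)
  then have "(m * g)\<^sup>2 = 1 - (cos g)\<^sup>2" by (simp add: sin_squared_eq)
  ultimately have "(m * l)\<^sup>2 - 2 * m * l * sin l + 1 \<le> (cos g)\<^sup>2"
    by (simp add: power2_eq_square algebra_simps)
  then have "(cos l)\<^sup>2 + (sin l - m * l)\<^sup>2 \<le> (cos g)\<^sup>2"
    using sin_cos_squared_add[of l] unfolding power2_diff power_mult_distrib by (simp add: ac_simps cos_squared_eq)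
  moreover have "Re (exp (\<i> * complex_of_real l) - \<i> * complex_of_real (sin g / g * l)) = cos l"
    "Im (exp (\<i> * complex_of_real l) - \<i> * complex_of_real (sin g / g * l)) = sin l - m * l"
    by (simp_all add: m_def Re_exp Im_exp)
  ultimately have "(cmod (exp (\<i> * complex_of_real l) - \<i> * complex_of_real (sin g / g * l)))\<^sup>2 \<le> (cos g)\<^sup>2"
    by (simp only: cmod_power2)
  moreover have "0 \<le> cos g" using g by (intro cos_ge_zero) auto
  ultimately show ?thesis by (rule power2_le_imp_le)
qed

lemma cmod_exp_minus_chord_le:
  assumes "0 < g" "g \<le> \<bar>l\<bar>" "\<bar>l\<bar> \<le> pi / 2"
  shows "cmod (exp (\<i> * complex_of_real l) - \<i> * complex_of_real (sin g / g * l)) \<le> cos g"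
proof (cases "0 \<le> l")
  case False
  have "cnj (exp (\<i> * complex_of_real l) - \<i> * complex_of_real (sin g / g * l)) =
      exp (\<i> * complex_of_real (- l)) - \<i> * complex_of_real (sin g / g * (- l))"
    by (simp add: exp_cnj)
  then show ?thesis
    using cmod_exp_minus_chord_le_aux[of g "- l"] assms False by (metis abs_of_neg complex_mod_cnj not_le)
qed (use cmod_exp_minus_chord_le_aux assms in simp)

section \<open>Spectral values and geodesics\<close>

text \<open>\<open>abs_op\<close> is known only through its defining property, so the eigenvectors
  of \<open>A\<close> need not come from \<open>E\<close>. Taking an eigenvector \<open>f\<close> of
  \<open>A\<close> not orthogonal to \<open>e\<close> and evaluating
  \<open>cinner (A (A e)) f\<close> in both bases shows that \<open>\<bar>l e\<bar>\<close> is an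
  eigenvalue of \<open>A\<close>.\<close>

lemma min_spectral_abs_op_le:
  assumes X: "operator_on M X" and E: "onb E M"
    and eig: "\<And>e. e \<in> E \<Longrightarrow> X e = complex_of_real (l e) *\<^sub>C e" and e: "e \<in> E"
  shows "min_spectral M (abs_op M X) \<le> \<bar>l e\<bar>"
proof -
  let ?l = "\<lambda>e. complex_of_real (l e)" and ?al = "\<lambda>e. complex_of_real \<bar>l e\<bar>"
  have X_diag: "X x = diag_op E ?l x" if "x \<in> M" for x
    by (rule operator_on_eq_diag_op[OF X E eig that])
  have X_cinner: "cinner (X x) (X y) = (\<Sum>e\<in>E. complex_of_real ((l e)\<^sup>2) * cinner x e * cnj (cinner y e))"
    if "x \<in> M" "y \<in> M" for x y
  proof -
    have "cinner (X x) (X y) = (\<Sum>e\<in>E. ?l e * cinner x e * cnj (cinner (X y) e))"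
      unfolding X_diag[OF that(1)] cinner_diag_op ..
    moreover have "cinner (X y) e = ?l e * cinner y e" if "e \<in> E" for e
      unfolding X_diag[OF \<open>y \<in> M\<close>] by (rule cinner_diag_op_basis[OF E that])
    ultimately show ?thesis by (simp add: power2_eq_square ac_simps)
  qed
  define A where "A = abs_op M X"
  \<comment> \<open>The diagonal operator of absolute values witnesses that the \<open>SOME\<close>
    in \<open>abs_op\<close> is satisfiable.\<close>
  have "positive_on M (diag_op E ?al)"
  proof -
    have "cinner (diag_op E ?al x) x \<in> \<real>\<^sub>\<ge>\<^sub>0" for x
    proof -
      have "cinner (diag_op E ?al x) x = complex_of_real (\<Sum>e\<in>E. \<bar>l e\<bar> * (cmod (cinner x e))\<^sup>2)"
        unfolding cinner_diag_op of_real_sum of_real_mult complex_norm_square by (simp add: mult.assoc)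
      moreover have "0 \<le> (\<Sum>e\<in>E. \<bar>l e\<bar> * (cmod (cinner x e))\<^sup>2)" by (intro sum_nonneg) simp
      ultimately show ?thesis by (simp only: nonneg_Reals_of_real_iff)
    qed
    then show ?thesis by (simp add: positive_on_def operator_on_diag_op[OF E])
  qed
  moreover have "cinner (diag_op E ?al (diag_op E ?al x)) y = cinner (X x) (X y)"
    if "x \<in> M" "y \<in> M" for x y
    unfolding diag_op_diag_op[OF E] cinner_diag_op X_cinner[OF that]
    by (simp add: power2_eq_square flip: of_real_mult)
  ultimately have "\<exists>A. positive_on M A \<and> (\<forall>x\<in>M. \<forall>y\<in>M. cinner (A (A x)) y = cinner (X x) (X y))"
    by blast
  then have "positive_on M A \<and> (\<forall>x\<in>M. \<forall>y\<in>M. cinner (A (A x)) y = cinner (X x) (X y))"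
    unfolding A_def abs_op_def by (rule someI_ex)
  then have pos: "positive_on M A" and A_sq: "\<And>x y. x \<in> M \<Longrightarrow> y \<in> M \<Longrightarrow> cinner (A (A x)) y = cinner (X x) (X y)"
    by blast+
  have A: "operator_on M A" using pos by (simp add: positive_on_def)
  obtain F m where F: "onb F M" and m: "\<And>f. f \<in> F \<Longrightarrow> A f = complex_of_real (m f) *\<^sub>C f"
    using spectral_theorem[OF E positive_on_imp_selfadjoint_on[OF pos onb_subspace[OF E]]] by blast
  have eM: "e \<in> M" by (rule onb_mem[OF E e])
  have "\<exists>f\<in>F. cinner e f \<noteq> 0"
  proof (rule ccontr)
    assume "\<not> (\<exists>f\<in>F. cinner e f \<noteq> 0)"
    then have "cinner e e = 0" by (intro onb_orthogonal_all[OF F eM]) blast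
    then show False using onb_norm[OF E e] by simp
  qed
  then obtain f where f: "f \<in> F" "cinner e f \<noteq> 0" by blast
  have fM: "f \<in> M" by (rule onb_mem[OF F f(1)])
  have "A e = diag_op F (\<lambda>f. complex_of_real (m f)) e" "A (A e) = diag_op F (\<lambda>f. complex_of_real (m f)) (A e)"
    by (rule operator_on_eq_diag_op[OF A F m], use eM operator_on_in[OF A] in auto)+
  then have "complex_of_real (m f * m f) * cinner e f = cinner (A (A e)) f"
    using cinner_diag_op_basis[OF F f(1)] by simp
  also have "\<dots> = cinner (X e) (X f)" by (rule A_sq[OF eM fM])
  also have "\<dots> = (\<Sum>e'\<in>E. if e' = e then complex_of_real ((l e)\<^sup>2) * cnj (cinner f e) else 0)"
    unfolding X_cinner[OF eM fM] by (intro sum.cong) (auto simp: onb_cinner[OF E e])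
  also have "\<dots> = complex_of_real ((l e)\<^sup>2) * cinner e f"
    using e onb_finite[OF E] cinner_commute[of e f] by simp
  finally have "complex_of_real (m f * m f) = complex_of_real ((l e)\<^sup>2)"
    using f(2) by (simp only: mult_cancel_right) simp
  then have "(m f)\<^sup>2 = (l e)\<^sup>2" by (simp only: of_real_eq_iff power2_eq_square)
  moreover have "complex_of_real (m f) = cinner (A f) f"
    using m[OF f(1)] onb_cinner[OF F f(1) f(1)] by (simp add: cinner_scaleC_left)
  then have "complex_of_real (m f) \<in> \<real>\<^sub>\<ge>\<^sub>0" using pos fM by (simp add: positive_on_def)
  then have "0 \<le> m f" by (simp add: nonneg_Reals_of_real_iff)
  ultimately have "m f = \<bar>l e\<bar>" by (metis real_sqrt_abs abs_of_nonneg)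
  moreover have "min_spectral M A = Min (m ` F)" using f(1) by (intro min_spectral_diagonal[OF A F m]) auto
  moreover have "Min (m ` F) \<le> m f" using f(1) onb_finite[OF F] by simp
  ultimately show ?thesis by (simp add: A_def)
qed

text \<open>\<open>cinner (X z) z\<close> is the sum of the eigenvalues weighted by the squared
  moduli of the coordinates of \<open>z\<close>; if all eigenvalues were positive, it could not
  vanish.\<close>

lemma min_spectral_nonpos:
  assumes X: "operator_on M X" and E: "onb E M"
    and eig: "\<And>e. e \<in> E \<Longrightarrow> X e = complex_of_real (l e) *\<^sub>C e"
    and z: "z \<in> M" "z \<noteq> 0" "cinner (X z) z = 0"
  shows "min_spectral M X \<le> 0"
proof (rule ccontr)
  assume neg: "\<not> min_spectral M X \<le> 0"
  have nz: "(norm z)\<^sup>2 > 0" using z(2) by simp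
  then have "E \<noteq> {}" using norm_onb[OF E z(1)] by auto
  then have "Min (l ` E) > 0" using neg min_spectral_diagonal[OF X E eig] by simp
  then have pos: "l e \<ge> Min (l ` E)" "Min (l ` E) > 0" if "e \<in> E" for e
    using that onb_finite[OF E] by auto
  have Xz: "X z = diag_op E (\<lambda>e. complex_of_real (l e)) z"
    by (rule operator_on_eq_diag_op[OF X E eig z(1)])
  have "complex_of_real (\<Sum>e\<in>E. l e * (cmod (cinner z e))\<^sup>2) = cinner (X z) z"
    unfolding Xz cinner_diag_op of_real_sum of_real_mult complex_norm_square by (simp add: mult.assoc)
  then have zero: "(\<Sum>e\<in>E. l e * (cmod (cinner z e))\<^sup>2) = 0"
    unfolding z(3) by (simp only: of_real_eq_0_iff)
  have "0 < Min (l ` E) * (norm z)\<^sup>2" using nz \<open>Min (l ` E) > 0\<close> by simp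
  also have "\<dots> \<le> (\<Sum>e\<in>E. l e * (cmod (cinner z e))\<^sup>2)"
    unfolding norm_onb[OF E z(1)] sum_distrib_left
    by (intro sum_mono mult_right_mono pos(1)) auto
  finally show False using zero by simp
qed

lemma opnorm_geodesic_le:
  assumes X: "operator_on M X" and E: "onb E M"
    and eig: "\<And>e. e \<in> E \<Longrightarrow> X e = complex_of_real (l e) *\<^sub>C e"
    and g: "0 < g" "g \<le> pi / 2" "\<And>e. e \<in> E \<Longrightarrow> g \<le> \<bar>l e\<bar> \<and> \<bar>l e\<bar> \<le> pi / 2"
    and S: "csubspace S" "S \<subseteq> M" "X ` S \<subseteq> ocompl M S"
    and T: "csubspace T" "T \<subseteq> M" "exp_op (\<lambda>x. \<i> *\<^sub>C X x) ` S = T"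
  shows "opnorm_on M (proj S \<circ> proj T) \<le> cos g"
proof (rule opnorm_on_le)
  show M: "csubspace M" by (rule onb_subspace[OF E])
  show cg: "0 \<le> cos g" using g by (intro cos_ge_zero) auto
  obtain B where B: "onb B S" using onb_exists_subspace[OF E S(1,2)] by blast
  obtain C where C: "onb C T" using onb_exists_subspace[OF E T(1,2)] by blast
  fix x assume "x \<in> M"
  have iX: "operator_on M (\<lambda>x. \<i> *\<^sub>C X x)"
    using X M by (auto simp: operator_on_def complex_vector.subspace_scale scaleC_add_right scaleC_scaleC
        mult.commute norm_scaleC)
  \<comment> \<open>Vectors of \<open>T\<close> come from \<open>S\<close> through the exponential,
    which preserves norms since the \<open>l e\<close> are real; hence \<open>z\<close> is no longer
    than \<open>x\<close>.\<close>
  obtain z where z: "z \<in> S" "proj T x = exp_op (\<lambda>x. \<i> *\<^sub>C X x) z"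
    using proj_in[OF C, of x] T(3) by blast
  have zM: "z \<in> M" using z(1) S(2) by blast
  have Uz: "proj T x = diag_op E (\<lambda>e. exp (\<i> * complex_of_real (l e))) z"
    unfolding z(2) by (rule exp_op_diagonal[OF iX E _ zM]) (simp add: eig scaleC_scaleC)
  have "(norm (proj T x))\<^sup>2 = (norm z)\<^sup>2"
    unfolding norm_onb[OF E zM] Uz norm_onb[OF E diag_op_in[OF E]]
    by (intro sum.cong) (simp_all add: cinner_diag_op_basis[OF E] norm_mult)
  then have nz: "norm z \<le> norm x"
    using norm_proj_le[OF C, of x] by (simp add: power2_eq_iff_nonneg)
  define w where "w = proj S (proj T x)"
  have w: "w \<in> S" unfolding w_def by (rule proj_in[OF B])
  \<comment> \<open>\<open>v\<close> differs from \<open>proj T x\<close> by a multiple of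
    \<open>X z\<close>, which is orthogonal to \<open>S\<close> and so invisible to
    \<open>w\<close>. With the slope \<open>sin g / g\<close> every diagonal entry has modulus at
    most \<open>cos g\<close>.\<close>
  define v where "v = diag_op E (\<lambda>e. exp (\<i> * complex_of_real (l e)) - \<i> * complex_of_real (sin g / g * l e)) z"
  have "norm v \<le> cos g * norm z"
    unfolding v_def using g cg by (intro norm_diag_op_le[OF E zM] cmod_exp_minus_chord_le) auto
  have Xz: "X z = diag_op E (\<lambda>e. complex_of_real (l e)) z"
    by (rule operator_on_eq_diag_op[OF X E eig zM])
  have v_eq: "v = proj T x - (\<i> * complex_of_real (sin g / g)) *\<^sub>C X z"
    unfolding Uz v_def Xz
    by (simp add: diag_op_def complex_vector.scale_sum_right scaleC_scaleC left_diff_distrib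
        complex_vector.scale_left_diff_distrib sum_subtractf mult.assoc)
  have "cinner (X z) w = 0" using S(3) z(1) w by (auto simp: ocompl_def)
  then have "cinner (proj T x) w = cinner v w"
    by (simp add: v_eq cinner_diff_left cinner_scaleC_left)
  moreover have "cinner w w = cinner (proj T x) w"
    by (subst (1) w_def) (rule cinner_proj_left[OF B w])
  ultimately have "(norm w)\<^sup>2 = cmod (cinner v w)" by (simp only: cmod_cinner_self[symmetric])
  also have "\<dots> \<le> norm v * norm w" by (rule cinner_Cauchy_Schwarz)
  finally have "norm w \<le> norm v" by (cases "w = 0") (simp_all add: power2_eq_square)
  also have "\<dots> \<le> cos g * norm z" by fact
  also have "\<dots> \<le> cos g * norm x" using nz cg by (rule mult_left_mono)
  finally show "norm ((proj S \<circ> proj T) x) \<le> cos g * norm x" by (simp add: w_def)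
qed

section \<open>Vanishing subspaces and the generic part\<close>

lemma ocompl_cspan: "ocompl M (cspan W) = ocompl M W"
  using cinner_span_eq_0[of _ W] complex_vector.span_base[of _ W] unfolding ocompl_def by blast

lemma vanishing_eq_ocompl:
  assumes "rkhs ev k"
  shows "vanishing ev W = ocompl UNIV (cspan (k ` W))"
  unfolding ocompl_cspan using rkhs.reproducing[OF assms] by (auto simp: vanishing_def ocompl_def)

text \<open>Three of the four summands reduce to 0, so the generic part is the double complement of
  the finite-dimensional \<open>K\<close>.\<close>

lemma generic_part_ocompl:
  assumes A: "onb E A" and B: "onb F B" and K: "onb G K" "ocompl UNIV K = ocompl UNIV A \<inter> ocompl UNIV B"
    and "A \<inter> B \<subseteq> {0}" "ocompl UNIV A \<inter> B \<subseteq> {0}" "A \<inter> ocompl UNIV B \<subseteq> {0}"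
  shows "generic_part (ocompl UNIV A) (ocompl UNIV B) = K"
proof -
  have "ocompl UNIV (ocompl UNIV A) = A" "ocompl UNIV (ocompl UNIV B) = B"
    using A B by (simp_all add: ocompl_ocompl)
  moreover have "0 \<in> A" "0 \<in> B" "0 \<in> ocompl UNIV A" "0 \<in> ocompl UNIV B"
    using onb_subspace[OF A] onb_subspace[OF B] by (simp_all add: complex_vector.subspace_0 ocompl_def)
  moreover from this have "A \<inter> B = {0}" "ocompl UNIV A \<inter> B = {0}" "A \<inter> ocompl UNIV B = {0}"
    using assms(5-7) by blast+
  ultimately have "{p + q + r + s | p q r s. p \<in> ocompl UNIV A \<inter> ocompl UNIV B \<and>
        q \<in> ocompl UNIV (ocompl UNIV A) \<inter> ocompl UNIV (ocompl UNIV B) \<and>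
        r \<in> ocompl UNIV A \<inter> ocompl UNIV (ocompl UNIV B) \<and>
        s \<in> ocompl UNIV (ocompl UNIV A) \<inter> ocompl UNIV B} = ocompl UNIV K"
    by (simp add: K(2) del: Int_iff)
  then show ?thesis
    unfolding generic_part_def using K(1) by (simp add: ocompl_ocompl)
qed

text \<open>The coordinates of a common vector with respect to \<open>S \<union> T\<close> are
  supported both in \<open>S\<close> and in \<open>T\<close>, hence nowhere.\<close>

lemma independent_disjoint_span_Int:
  assumes "complex_vector.independent (S \<union> T)" "S \<inter> T = {}"
  shows "cspan S \<inter> cspan T \<subseteq> {0}"
proof
  fix x assume x: "x \<in> cspan S \<inter> cspan T"
  have "complex_vector.representation (S \<union> T) x = complex_vector.representation S x"
    "complex_vector.representation (S \<union> T) x = complex_vector.representation T x"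
    using x assms(1) by (auto intro: complex_vector.representation_extend)
  then have zero: "complex_vector.representation (S \<union> T) x v = 0" for v
    using assms(2) complex_vector.representation_ne_zero[of S x v]
      complex_vector.representation_ne_zero[of T x v] by auto
  have "x \<in> cspan (S \<union> T)" using x complex_vector.span_mono[of S "S \<union> T"] by auto
  from complex_vector.sum_nonzero_representation_eq[OF assms(1) this]
  show "x \<in> {0}" by (simp add: zero)
qed

lemma cspan_range_expand:
  fixes f :: "'n::finite \<Rightarrow> 'h::complex_hilbert"
  assumes "inj f" "x \<in> cspan (range f)"
  shows "\<exists>c. x = (\<Sum>i\<in>UNIV. c i *\<^sub>C f i)"
proof -
  obtain u where "x = (\<Sum>v\<in>range f. u v *\<^sub>C v)"
    using assms(2) complex_vector.span_finite[of "range f"] by auto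
  then have "x = (\<Sum>i\<in>UNIV. u (f i) *\<^sub>C f i)" by (simp add: sum.reindex[OF assms(1)])
  then show ?thesis by (rule exI[of _ "\<lambda>i. u (f i)"])
qed

lemma matrix_vector_mult_eq_0:
  fixes A :: "'a::field^'n^'n"
  assumes "det A \<noteq> 0" "A *v x = 0"
  shows "x = 0"
  using assms matrix_left_invertible_ker[of A] invertible_det_nz[of A] by (auto simp: invertible_left_inverse)

section \<open>Spans of kernels\<close>

text \<open>Turns the dimension hypothesis on the kernels into independence and distinctness: a
  spanning family with as many members as the dimension has neither relations nor
  repetitions.\<close>

lemma independent_image_of_cdim:
  assumes "finite W" "cdim (cspan (f ` W)) = card W"
  shows "complex_vector.independent (f ` W)" "inj_on f W"
proof -
  obtain B where B: "B \<subseteq> f ` W" "complex_vector.independent B" "card B = cdim (f ` W)"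
    by (rule complex_vector.basis_exists)
  have dim: "cdim (f ` W) = card W" using assms(2) by simp
  have fin: "finite (f ` W)" using assms(1) by simp
  have "card B \<le> card (f ` W)" by (rule card_mono[OF fin B(1)])
  moreover have "card (f ` W) \<le> card W" by (rule card_image_le[OF assms(1)])
  ultimately have eq: "card B = card (f ` W)" "card (f ` W) = card W" using B(3) dim by linarith+
  have "B = f ` W" by (rule card_subset_eq[OF fin B(1) eq(1)])
  then show "complex_vector.independent (f ` W)" using B(2) by simp
  show "inj_on f W" by (rule eq_card_imp_inj_on[OF assms(1) eq(2)])
qed

text \<open>The notation for the smallest spectral value is introduced for positive operators, while
  \<open>X\<close> is only self-adjoint; the second estimate is therefore given for \<open>X\<close>
  and for its absolute value. \<open>kernels_dim\<close> comes from the description of the generic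
  part as the 2n-dimensional space generated by the kernels.\<close>

theorem corollary4p2:
  fixes ev :: "'h::complex_hilbert \<Rightarrow> 'x \<Rightarrow> complex"
    and k :: "'x \<Rightarrow> 'h"
    and a b :: "'n::finite \<Rightarrow> 'x"
    and X :: "'h \<Rightarrow> 'h"
  defines "H0 \<equiv> generic_part (vanishing ev (range a)) (vanishing ev (range b))"
  defines "Za \<equiv> vanishing ev (range a) \<inter> H0"
    and "Zb \<equiv> vanishing ev (range b) \<inter> H0"
  assumes "rkhs ev k"
    and infinite_dim: "\<not> (\<exists>B. finite B \<and> cspan B = (UNIV :: 'h set))"
    and "inj a" and "inj b" and "range a \<inter> range b = {}"
    and kernels_dim: "cdim (cspan (k ` (range a \<union> range b))) = 2 * CARD('n)"
    and "det (\<chi> i j. ev (k (b i)) (a j)) \<noteq> 0"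
    and "geodesic_exponent H0 Za Zb X"
  shows "\<forall>i j.
     (cmod (cinner (k (a i)) (k (b j))) / (norm (k (a i)) * norm (k (b j)))
        \<le> opnorm_on H0 (proj Za \<circ> proj Zb) \<and>
      opnorm_on H0 (proj Za \<circ> proj Zb) = opnorm_on H0 (proj_perp Za \<circ> proj_perp Zb) \<and>
      opnorm_on H0 (proj_perp Za \<circ> proj_perp Zb) < 1) \<and>
     (let t = arccos (cmod (ev (k (a i)) (b j)) /
                (sqrt (Re (ev (k (a i)) (a i))) * sqrt (Re (ev (k (b j)) (b j)))))
      in min_spectral H0 X \<le> t \<and>
         min_spectral H0 (abs_op H0 X) \<le> t \<and>
         t = arccos (cmod (cinner (k (a i)) (k (b j))) / (norm (k (a i)) * norm (k (b j)))))"
proof -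

  \<comment> \<open>The generic part and the spans of the kernels\<close>
  define K where "K = cspan (k ` (range a \<union> range b))"
  define A where "A = cspan (k ` range a)"
  define B where "B = cspan (k ` range b)"
  let ?M = "\<chi> i j. ev (k (b i)) (a j)"
  have rep: "ev f w = cinner f (k w)" for f w using rkhs.reproducing[OF \<open>rkhs ev k\<close>] .
  have card: "card (range a \<union> range b) = 2 * CARD('n)"
    using \<open>inj a\<close> \<open>inj b\<close> \<open>range a \<inter> range b = {}\<close> by (simp add: card_Un_disjoint card_image)
  have fin: "finite (range a \<union> range b)" by simp
  have "cdim (cspan (k ` (range a \<union> range b))) = card (range a \<union> range b)"
    by (simp only: kernels_dim card)
  note kernels = independent_image_of_cdim[OF fin this]
  have indep: "complex_vector.independent (k ` range a \<union> k ` range b)"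
    using kernels(1) unfolding image_Un .
  have inj: "inj_on k (range a \<union> range b)" by (rule kernels(2))
  have "inj_on k (range a)" "inj_on k (range b)" by (rule inj_on_subset[OF inj], simp)+
  then have injs: "inj (\<lambda>i. k (a i))" "inj (\<lambda>i. k (b i))"
    using comp_inj_on[OF \<open>inj a\<close>] comp_inj_on[OF \<open>inj b\<close>] by (simp_all add: comp_def)
  have knz: "k w \<noteq> 0" if "w \<in> range a \<union> range b" for w
  proof
    assume "k w = 0"
    then have "0 \<in> k ` range a \<union> k ` range b" using imageI[OF that, of k] by (simp add: image_Un)
    from complex_vector.dependent_zero[OF this] indep show False by (rule notE[rotated])
  qed
  obtain E F G where E: "onb E A" and F: "onb F B" and G: "onb G K"
    unfolding A_def B_def K_def using onb_exists fin by (meson finite_Un finite_imageI)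
  have A: "csubspace A" "A \<subseteq> K" and B: "csubspace B" "B \<subseteq> K" and K: "csubspace K"
    unfolding A_def B_def K_def by (rule complex_vector.subspace_span complex_vector.span_mono image_mono Un_upper1 Un_upper2)+
  have "k ` range a \<inter> k ` range b = {}"
    using inj_on_image_Int[OF inj, of "range a" "range b"] \<open>range a \<inter> range b = {}\<close> by simp
  then have AB: "A \<inter> B \<subseteq> {0}"
    unfolding A_def B_def by (rule independent_disjoint_span_Int[OF indep])
  \<comment> \<open>The entries of \<open>?M\<close> are the inner products of
    \<open>k (b i)\<close> with \<open>k (a j)\<close>; orthogonality to \<open>A\<close> puts the
    coefficients of \<open>x\<close> in the kernel of the transpose, which is trivial as the
    determinant is nonzero.\<close>
  have AB': "ocompl UNIV A \<inter> B \<subseteq> {0}"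
  proof
    fix x assume x: "x \<in> ocompl UNIV A \<inter> B"
    then obtain c where c: "x = (\<Sum>i\<in>UNIV. c i *\<^sub>C k (b i))"
      using cspan_range_expand[OF injs(2), of x] by (auto simp: B_def image_image)
    have "cinner x (k (a j)) = 0" for j
      using x complex_vector.span_base[of "k (a j)" "k ` range a"] by (auto simp: ocompl_def A_def)
    then have "transpose ?M *v (\<chi> i. c i) = 0"
      by (simp add: vec_eq_iff matrix_vector_mult_def transpose_def c rep cinner_sum_left
          cinner_scaleC_left mult.commute)
    then have "(\<chi> i. c i) = (0 :: complex^'n)"
      using matrix_vector_mult_eq_0[of "transpose ?M"] \<open>det ?M \<noteq> 0\<close> by (simp add: det_transpose)
    then show "x \<in> {0}" by (simp add: c vec_eq_iff)
  qed
  \<comment> \<open>Conjugate linearity in the second argument now puts the conjugated coefficients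
    in the kernel of \<open>?M\<close> itself.\<close>
  have A'B: "A \<inter> ocompl UNIV B \<subseteq> {0}"
  proof
    fix x assume x: "x \<in> A \<inter> ocompl UNIV B"
    then obtain c where c: "x = (\<Sum>i\<in>UNIV. c i *\<^sub>C k (a i))"
      using cspan_range_expand[OF injs(1), of x] by (auto simp: A_def image_image)
    have "cinner (k (b j)) x = 0" for j
      using x complex_vector.span_base[of "k (b j)" "k ` range b"]
      by (subst cinner_eq_0_commute) (auto simp: ocompl_def B_def)
    then have "?M *v (\<chi> i. cnj (c i)) = 0"
      by (simp add: vec_eq_iff matrix_vector_mult_def c rep cinner_sum_right
          cinner_scaleC_right mult.commute)
    then have "(\<chi> i. cnj (c i)) = (0 :: complex^'n)"
      using matrix_vector_mult_eq_0[of ?M] \<open>det ?M \<noteq> 0\<close> by simp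
    then show "x \<in> {0}" by (simp add: c vec_eq_iff)
  qed
  have K_perp: "ocompl UNIV K = ocompl UNIV A \<inter> ocompl UNIV B"
    unfolding K_def A_def B_def ocompl_cspan by (auto simp: ocompl_def)
  have van: "vanishing ev (range a) = ocompl UNIV A" "vanishing ev (range b) = ocompl UNIV B"
    by (simp_all add: vanishing_eq_ocompl[OF \<open>rkhs ev k\<close>] A_def B_def)
  have H0: "H0 = K"
    unfolding H0_def van by (rule generic_part_ocompl[OF E F G K_perp AB AB' A'B])
  have Za: "Za = ocompl K A" and Zb: "Zb = ocompl K B"
    by (auto simp: Za_def Zb_def H0 van ocompl_def)
  have K_int: "ocompl K A \<inter> ocompl K B \<subseteq> {0}"
  proof
    fix x assume "x \<in> ocompl K A \<inter> ocompl K B"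
    then have "x \<in> K" "x \<in> ocompl UNIV K" unfolding K_perp by (auto simp: ocompl_def)
    then have "cinner x x = 0" by (simp add: ocompl_def)
    then show "x \<in> {0}" by simp
  qed

  \<comment> \<open>Norms of the products of projections\<close>
  define s where "s = opnorm_on K (proj A \<circ> proj B)"
  have s_eq: "opnorm_on K (proj Za \<circ> proj Zb) = s"
    unfolding Za Zb s_def by (rule opnorm_ocompl_eq[OF G A B AB K_int])
  \<comment> \<open>On \<open>K\<close>, removing the projection onto the complement of
    \<open>A\<close> leaves the projection onto \<open>A\<close>; \<open>proj B x\<close> stays in
    \<open>K\<close>, so this applies to both factors.\<close>
  have "(proj_perp Za \<circ> proj_perp Zb) x = (proj A \<circ> proj B) x" if "x \<in> K" for x
  proof -
    have "proj B x \<in> K" using proj_in[OF F] B(2) by blast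
    then show ?thesis using that
      by (simp add: proj_perp_def Za Zb proj_ocompl[OF E K A(2)] proj_ocompl[OF F K B(2)])
  qed
  then have s_perp: "opnorm_on K (proj_perp Za \<circ> proj_perp Zb) = s"
    unfolding s_def by (rule opnorm_on_cong)
  have s_less: "s < 1" unfolding s_def by (rule opnorm_proj_proj_less_1[OF G A B AB])
  have op: "operator_on K (proj A \<circ> proj B)" by (rule operator_on_proj_proj[OF E F A(2)])

  \<comment> \<open>Spectrum of the geodesic exponent\<close>
  have "selfadjoint_on K X" and X_norm: "opnorm_on K X \<le> pi / 2"
    and X_Za: "X ` Za \<subseteq> ocompl K Za" and X_exp: "exp_op (\<lambda>x. \<i> *\<^sub>C X x) ` Za = Zb"
    using \<open>geodesic_exponent H0 Za Zb X\<close> by (simp_all add: geodesic_exponent_def H0)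
  obtain C l where C: "onb C K" and l: "\<And>e. e \<in> C \<Longrightarrow> X e = complex_of_real (l e) *\<^sub>C e"
    using spectral_theorem[OF G \<open>selfadjoint_on K X\<close>] by blast
  have X: "operator_on K X" using \<open>selfadjoint_on K X\<close> by (simp add: selfadjoint_on_def)
  have l_bound: "\<bar>l e\<bar> \<le> pi / 2" if "e \<in> C" for e
    using norm_le_opnorm_on[OF X K onb_mem[OF C that]] X_norm
    by (simp add: l[OF that] norm_scaleC onb_norm[OF C that])

  have k_mem: "k (a i) \<in> A" "k (b i) \<in> B" for i
    unfolding A_def B_def by (auto intro: complex_vector.span_base)
  \<comment> \<open>Since \<open>A\<close> and \<open>B\<close> meet only in 0,
    \<open>k (b j)\<close> is not in \<open>A\<close>; its component orthogonal to \<open>A\<close>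
    is a nonzero vector of \<open>Za\<close>, where the quadratic form of \<open>X\<close>
    vanishes.\<close>
  obtain z where z: "z \<in> Za" "z \<noteq> 0"
  proof -
    fix j :: 'n
    define z where "z = k (b j) - proj A (k (b j))"
    have "z \<in> Za" unfolding z_def Za
      using k_mem(2) B(2) by (intro proj_perp_in_ocompl[OF E K A(2)]) auto
    moreover have "z \<noteq> 0"
    proof
      assume "z = 0"
      then have "k (b j) \<in> A" using proj_in[OF E, of "k (b j)"] by (simp add: z_def)
      then show False using k_mem(2)[of j] AB knz[of "b j"] by blast
    qed
    ultimately show ?thesis by (rule that)
  qed
  have zK: "z \<in> K" using z(1) by (simp add: Za ocompl_def)
  have "cinner (X z) z = 0" using X_Za z(1) by (auto simp: ocompl_def)
  then have min_X: "min_spectral K X \<le> 0" by (intro min_spectral_nonpos[OF X C l zK z(2)])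

  have "C \<noteq> {}" using norm_onb[OF C zK] z(2) by auto
  \<comment> \<open>The least absolute value of an eigenvalue of \<open>X\<close>; it is attained,
    so it bounds the smallest spectral value of \<open>abs_op K X\<close> from above.\<close>
  define g where "g = Min ((\<lambda>e. \<bar>l e\<bar>) ` C)"
  have "g \<in> (\<lambda>e. \<bar>l e\<bar>) ` C"
    unfolding g_def using \<open>C \<noteq> {}\<close> onb_finite[OF C] by (intro Min_in) auto
  then obtain e where e: "e \<in> C" "g = \<bar>l e\<bar>" by blast
  have g: "0 \<le> g" "g \<le> pi / 2" using l_bound[OF e(1)] e(2) by auto
  have g_le: "g \<le> \<bar>l e\<bar>" if "e \<in> C" for e
    unfolding g_def using that onb_finite[OF C] by auto
  have min_abs: "min_spectral K (abs_op K X) \<le> g"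
    unfolding e(2) by (rule min_spectral_abs_op_le[OF X C l e(1)])
  \<comment> \<open>The slope \<open>sin g / g\<close> asks for \<open>0 < g\<close>; for
    \<open>g = 0\<close> the final bound is the nonnegativity of \<open>arccos\<close>.\<close>
  have s_cos: "s \<le> cos g" if "0 < g"
    unfolding s_eq[symmetric]
  proof (rule opnorm_geodesic_le[OF X C l that g(2)])
    show "csubspace Za" "csubspace Zb" unfolding Za Zb by (rule ocompl_subspace[OF K])+
    show "Za \<subseteq> K" "Zb \<subseteq> K" by (auto simp: Za Zb ocompl_def)
  qed (use g_le l_bound X_Za X_exp in auto)

  \<comment> \<open>The estimates for a pair of kernels\<close>
  show ?thesis
    unfolding H0
  proof (intro allI)
    fix i j
    let ?\<rho> = "cmod (cinner (k (a i)) (k (b j))) / (norm (k (a i)) * norm (k (b j)))"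
    have pos: "0 < norm (k (a i)) * norm (k (b j))" using knz[of "a i"] knz[of "b j"] by simp
    \<comment> \<open>As \<open>k (a i)\<close> lies in \<open>A\<close> and \<open>k (b j)\<close>
      in \<open>B\<close>, both projections can be inserted without changing the inner product,
      which brings in the factor \<open>s\<close>.\<close>
    have "cinner (k (a i)) (k (b j)) = cinner (k (a i)) (proj A (proj B (k (b j))))"
      using cinner_proj_right[OF E k_mem(1)] proj_id[OF F k_mem(2)] by simp
    also have "cmod \<dots> \<le> norm (k (a i)) * norm (proj A (proj B (k (b j))))"
      by (rule cinner_Cauchy_Schwarz)
    also have "\<dots> \<le> norm (k (a i)) * (s * norm (k (b j)))"
      using norm_le_opnorm_on[OF op K, of "k (b j)"] k_mem(2)[of j] B(2)
      by (intro mult_left_mono) (auto simp: s_def)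
    finally have \<rho>: "?\<rho> \<le> s" using pos by (simp add: divide_le_eq mult.left_commute)
    have "0 \<le> ?\<rho>" by simp
    then have lower: "- 1 \<le> ?\<rho>" by linarith
    have upper: "?\<rho> \<le> 1" using \<rho> s_less by linarith
    have nonneg: "0 \<le> arccos ?\<rho>" by (rule arccos_lbound[OF lower upper])
    moreover have "g \<le> arccos ?\<rho>"
    proof (cases "g = 0")
      case False
      then have "?\<rho> \<le> cos g" using \<rho> s_cos g(1) by linarith
      then have "arccos (cos g) \<le> arccos ?\<rho>" by (intro arccos_le_arccos lower cos_le_one)
      then show ?thesis using g by (simp add: arccos_cos)
    qed (use nonneg in simp)
    moreover have "Re (ev (k w) w) = (norm (k w))\<^sup>2" for w
      unfolding rep cinner_self by simp
    ultimately show "(?\<rho> \<le> opnorm_on K (proj Za \<circ> proj Zb) \<and>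
        opnorm_on K (proj Za \<circ> proj Zb) = opnorm_on K (proj_perp Za \<circ> proj_perp Zb) \<and>
        opnorm_on K (proj_perp Za \<circ> proj_perp Zb) < 1) \<and>
      (let t = arccos (cmod (ev (k (a i)) (b j)) /
                (sqrt (Re (ev (k (a i)) (a i))) * sqrt (Re (ev (k (b j)) (b j)))))
       in min_spectral K X \<le> t \<and> min_spectral K (abs_op K X) \<le> t \<and> t = arccos ?\<rho>)"
      using \<rho> s_eq s_perp s_less min_X min_abs by (simp add: rep[of _ "b j" for j] rep Let_def)
  qed
qed

end
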